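(* Let $\{V(x)\}_{x\in\mathbb{G}}$ be i.i.d. real random variables. Fix $E\in\mathbb{R}$. Then the limit $$N(E)=\lim_{L\to\infty}\frac{1}{|\mathbb{G}_L|}\mathbb{E}\,\mathcal N(E;X^L)=\lim_{L\to\infty}\frac{1}{|\mathbb{G}_L|}\mathcal N(E;X^L)\quad\text{almost surely}$$ exists, is non-random, and is the same for every choice of $X^L\in\mathcal T_L:=\{H^{\mathbb{G}_L,\bullet},H^{\widetilde{\mathbb{G}}_L,\bullet}:\bullet\in\{S,N,D\}\}$ (this is the integrated density of states on the right half Sierpinski lattice $\bigcup_L\mathbb{G}_L$). Moreover, with $B_L=\{y\in\mathbb{G}:d(O,y)\le2^L\}=\mathbb{G}_L\cup\mathbb{G}_L'$, for any boundary condition $\bullet\in\{S,N,D\}$, $$N(E)=\lim_{L\to\infty}\frac{1}{|B_L|}\mathbb{E}\,\mathcal N(E;H^{B_L,\bullet})=\lim_{L\to\infty}\frac{1}{|B_L|}\mathcal N(E;H^{B_L,\bullet})\quad\text{almost surely}.$$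
   Context: Let $a_1=(0,0)$, $a_2=(1,0)$, $a_3=(1/2,\sqrt3/2)$, $T_0$ the unit equilateral triangle with these vertices, $T_{n+1}=T_n\cup(T_n+2^na_2)\cup(T_n+2^na_3)$. $\mathbb{G}_n$ is the set of vertices of unit triangles (translates of $T_0$) in $T_n$, with $x\sim y$ iff $x\ne y$ lie on a common unit triangle; $|\mathbb{G}_n|=(3^{n+1}+3)/2$. The Sierpinski lattice is $\mathbb{G}=\bigcup_n(\mathbb{G}_n\cup\mathbb{G}_n')$, $\mathbb{G}_n'$ the mirror image in the $y$-axis; $d$ is graph distance, $O=(0,0)$; $\deg(x)=4$ is the degree in $\mathbb{G}$ and $\deg_A(x)=\#\{y\in A:y\sim x\}$. The truncated triangle $\widetilde{\mathbb{G}}_L$ is $\mathbb{G}_L$ with its three corner (extreme) vertices removed. For finite $A\subseteq\mathbb{G}$, $f\in\ell^2(A)$: $-\Delta^{A,S}f(x)=\deg(x)f(x)-\sum_{y\in A,y\sim x}f(y)$; $-\Delta^{A,N}f(x)=\deg_A(x)f(x)-\sum_{y\in A,y\sim x}f(y)$; $-\Delta^{A,D}f(x)=(2\deg(x)-\deg_A(x))f(x)-\sum_{y\in A,y\sim x}f(y)$; and $H^{A,\bullet}=-\Delta^{A,\bullet}+V|_A$ on $\ell^2(A)$. $\mathcal N(E;X)$ is the number of eigenvalues (with multiplicity) of $X$ that are $\le E$. *)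

theory Defs
  imports "HOL-Probability.Probability" "Jordan_Normal_Form.Char_Poly"
begin

type_synonym pt = "real \<times> real"

definition a1 :: pt where "a1 = (0, 0)"
definition a2 :: pt where "a2 = (1, 0)"
definition a3 :: pt where "a3 = (1/2, sqrt 3 / 2)"

definition T0 :: "pt set" where "T0 = convex hull {a1, a2, a3}"

fun Tn :: "nat \<Rightarrow> pt set" where
  "Tn 0 = T0"
| "Tn (Suc n) = Tn n \<union> (\<lambda>p. p + (2 ^ n) *\<^sub>R a2) ` Tn n \<union> (\<lambda>p. p + (2 ^ n) *\<^sub>R a3) ` Tn n"

definition unit_tris :: "nat \<Rightarrow> pt set" where
  "unit_tris n = {t. (\<lambda>p. t + p) ` T0 \<subseteq> Tn n}"

definition tri_vertices :: "pt \<Rightarrow> pt set" where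
  "tri_vertices t = {t + a1, t + a2, t + a3}"

definition Gn :: "nat \<Rightarrow> pt set" where
  "Gn n = (\<Union>t\<in>unit_tris n. tri_vertices t)"

definition mir :: "pt \<Rightarrow> pt" where "mir p = (- fst p, snd p)"

definition Gn' :: "nat \<Rightarrow> pt set" where "Gn' n = mir ` Gn n"

definition SG :: "pt set" where "SG = (\<Union>n. Gn n \<union> Gn' n)"

definition adj :: "pt \<Rightarrow> pt \<Rightarrow> bool" where
  "adj x y \<longleftrightarrow> x \<noteq> y \<and> (\<exists>n. \<exists>t\<in>unit_tris n.
      {x, y} \<subseteq> tri_vertices t \<or> {x, y} \<subseteq> mir ` tri_vertices t)"

definition deg :: "pt \<Rightarrow> nat" where "deg x = card {y \<in> SG. adj x y}"

definition deg_in :: "pt set \<Rightarrow> pt \<Rightarrow> nat" where "deg_in A x = card {y \<in> A. adj x y}"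

definition Gtilde :: "nat \<Rightarrow> pt set" where
  "Gtilde L = Gn L - {a1, (2 ^ L) *\<^sub>R a2, (2 ^ L) *\<^sub>R a3}"

text \<open>B_L = G_L \<union> G_L' (the graph ball of radius 2^L around O).\<close>
definition BL :: "nat \<Rightarrow> pt set" where "BL L = Gn L \<union> Gn' L"

datatype bc = Simple | Neumann | Dirichlet

definition diag_bc :: "bc \<Rightarrow> pt set \<Rightarrow> pt \<Rightarrow> real" where
  "diag_bc b A x = (case b of
      Simple \<Rightarrow> real (deg x)
    | Neumann \<Rightarrow> real (deg_in A x)
    | Dirichlet \<Rightarrow> 2 * real (deg x) - real (deg_in A x))"

text \<open>Kernel of H^{A,b} = -Delta^{A,b} + V|_A on l^2(A) (entries for x, y in A).\<close>
definition Hker :: "pt set \<Rightarrow> bc \<Rightarrow> (pt \<Rightarrow> real) \<Rightarrow> pt \<Rightarrow> pt \<Rightarrow> real" where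
  "Hker A b v x y = (if x = y then diag_bc b A x + v x else 0) - (if adj x y then 1 else 0)"

definition op_matrix :: "'a set \<Rightarrow> ('a \<Rightarrow> 'a \<Rightarrow> real) \<Rightarrow> real Matrix.mat" where
  "op_matrix A K = (let xs = (SOME xs. distinct xs \<and> set xs = A)
     in Matrix.mat (card A) (card A) (\<lambda>(i, j). K (xs ! i) (xs ! j)))"

definition ev_count :: "real \<Rightarrow> real Matrix.mat \<Rightarrow> nat" where
  "ev_count E X = (\<Sum>r\<in>{r. r \<le> E \<and> poly (char_poly X) r = 0}. order r (char_poly X))"

definition Ncount :: "real \<Rightarrow> pt set \<Rightarrow> bc \<Rightarrow> (pt \<Rightarrow> real) \<Rightarrow> nat" where
  "Ncount E A b v = ev_count E (op_matrix A (Hker A b v))"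

datatype region = Full | Truncated

definition region_set :: "region \<Rightarrow> nat \<Rightarrow> pt set" where
  "region_set r L = (case r of Full \<Rightarrow> Gn L | Truncated \<Rightarrow> Gtilde L)"

end

theory Submission
  imports Defs
begin

text \<open>By Cauchy interlacing, passing from a kernel on \<open>A\<close> to its restriction to \<open>C \<subseteq> A\<close> changes the
  number of eigenvalues \<open>\<le> E\<close> by at most the number of removed points. All six operators on the
  triangle of level \<open>n\<close> agree away from a bounded neighbourhood of its corners, so their counting
  functions differ by \<open>O(1)\<close>; and removing the junction points splits the triangle of level
  \<open>n + 1\<close> into three uncoupled translates of the truncated triangle of level \<open>n\<close>. Hence the count
  \<open>Y\<close> satisfies \<open>Y (n + 1) =\<close> (sum of three i.i.d. copies of \<open>Y n\<close>) \<open>+ O(1)\<close>. The means then obey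
  \<open>m (n + 1) = 3 m n + O(1)\<close>, so \<open>m n / 3 ^ n\<close> converges, and the variances obey
  \<open>w (n + 1) \<le> 4 w n + O(1)\<close>, so \<open>w n / 9 ^ n\<close> is summable and \<open>(Y n - m n) / 3 ^ n\<close> tends to \<open>0\<close>
  almost surely. The balls \<open>BL n\<close> split in the same way into a triangle and its mirror image.\<close>

subsection \<open>Underdetermined linear systems\<close>

text \<open>\<open>ev_count\<close> reads multiplicities off the characteristic polynomial of a
  matrix in an unspecified listing of the points. Eigenbases turn it into a dimension count, where
  the min-max principle applies. The reference operator is the simple Laplacian on the truncated
  triangle. Its kernel restricts one kernel of the whole lattice, so different sets are compared by
  deleting points alone. Truncation also makes the three blocks disjoint, hence their counts exactly
  independent; full triangles share corners. Unequal diagonals caused by boundary conditions are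
  treated by deleting the affected points too, so every O(1) is a number of deleted points. The
  factor 4 in the variance recursion is 3 * 4/3: three uncorrelated copies give 3, and a bounded
  error r is absorbed by (S + r)^2 <= 4/3 S^2 + 4 r^2. Any factor below 9 would make the normalised
  variances summable.\<close>

lemma underdetermined_system:
  fixes a :: "'j \<Rightarrow> 'i \<Rightarrow> real"
  assumes "finite J" "finite I" "card J < card I"
  shows "\<exists>c. (\<exists>i\<in>I. c i \<noteq> 0) \<and> (\<forall>j\<in>J. (\<Sum>i\<in>I. a j i * c i) = 0)"
  using assms
proof (induction J arbitrary: I a rule: finite_induct)
  case empty
  then obtain i where "i \<in> I" by fastforce
  then show ?case by (intro exI[of _ "\<lambda>_. 1"]) auto
next
  case (insert j J)
  show ?case
  proof (cases "\<exists>k\<in>I. a j k \<noteq> 0")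
    case False
    then have "(\<Sum>i\<in>I. a j i * c i) = 0" for c by (intro sum.neutral) auto
    moreover have "card J < card I" using insert by simp
    ultimately show ?thesis using insert.IH[of I a] insert.prems by auto
  next
    case True
    then obtain k where k: "k \<in> I" "a j k \<noteq> 0" by blast
    define I' where "I' = I - {k}"
    have I': "finite I'" "k \<notin> I'" "I = insert k I'" using insert.prems k by (auto simp: I'_def)
    then have "card J < card I'" using insert.prems insert.hyps by simp
    then obtain c where c: "\<exists>i\<in>I'. c i \<noteq> 0"
      "\<forall>j'\<in>J. (\<Sum>i\<in>I'. (a j' i - a j' k * a j i / a j k) * c i) = 0"
      using insert.IH[of I' "\<lambda>j' i. a j' i - a j' k * a j i / a j k"] I' by blast
    \<comment> \<open>Gaussian elimination: equation \<open>j\<close> was used to remove the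
      variable \<open>k\<close> from the other equations, and this value at \<open>k\<close> now
      solves equation \<open>j\<close> itself.\<close>
    define d where "d = c(k := - (\<Sum>i\<in>I'. a j i * c i) / a j k)"
    have d: "(\<Sum>i\<in>I. a j' i * d i) = a j' k * d k + (\<Sum>i\<in>I'. a j' i * c i)" for j'
    proof -
      have "(\<Sum>i\<in>I'. a j' i * d i) = (\<Sum>i\<in>I'. a j' i * c i)"
        using I' by (intro sum.cong) (auto simp: d_def)
      then show ?thesis using I' by simp
    qed
    have "(\<Sum>i\<in>I. a j' i * d i) = 0" if "j' \<in> J" for j'
    proof -
      have "(\<Sum>i\<in>I'. (a j' i - a j' k * a j i / a j k) * c i)
          = (\<Sum>i\<in>I'. a j' i * c i) - (\<Sum>i\<in>I'. (a j' k / a j k) * (a j i * c i))"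
        by (simp add: sum_subtractf[symmetric] algebra_simps)
      also have "\<dots> = (\<Sum>i\<in>I'. a j' i * c i) + a j' k * d k"
        by (simp add: d_def sum_distrib_left sum_divide_distrib)
      finally show ?thesis using c(2) that by (simp add: d)
    qed
    moreover have "(\<Sum>i\<in>I. a j i * d i) = 0"
      unfolding d using k by (simp add: d_def)
    moreover have "\<exists>i\<in>I. d i \<noteq> 0" using c(1) I' by (auto simp: d_def)
    ultimately show ?thesis by (intro exI[of _ d]) auto
  qed
qed

subsection \<open>Quadratic forms on functions over a finite set\<close>

definition ip :: "'a set \<Rightarrow> ('a \<Rightarrow> real) \<Rightarrow> ('a \<Rightarrow> real) \<Rightarrow> real" where
  "ip A f g = (\<Sum>x\<in>A. f x * g x)"

definition bform :: "'a set \<Rightarrow> ('a \<Rightarrow> 'a \<Rightarrow> real) \<Rightarrow> ('a \<Rightarrow> real) \<Rightarrow> ('a \<Rightarrow> real) \<Rightarrow> real" where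
  "bform A K f g = (\<Sum>x\<in>A. f x * (\<Sum>y\<in>A. K x y * g y))"

text \<open>Vectors of l^2(A) are total functions vanishing off \<open>A\<close>. Extension by zero
  from a subset is then the identity map, so one function can be tested on several sets.\<close>

definition supp_in :: "'a set \<Rightarrow> ('a \<Rightarrow> real) \<Rightarrow> bool" where
  "supp_in A f \<longleftrightarrow> (\<forall>x. x \<notin> A \<longrightarrow> f x = 0)"

definition sym_on :: "'a set \<Rightarrow> ('a \<Rightarrow> 'a \<Rightarrow> real) \<Rightarrow> bool" where
  "sym_on A K \<longleftrightarrow> (\<forall>x\<in>A. \<forall>y\<in>A. K x y = K y x)"

definition orthonormal_in :: "'a set \<Rightarrow> ('a \<Rightarrow> real) set \<Rightarrow> bool" where
  "orthonormal_in A U \<longleftrightarrow> finite U \<and> (\<forall>u\<in>U. supp_in A u) \<and>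
     (\<forall>u\<in>U. \<forall>w\<in>U. ip A u w = (if u = w then 1 else 0))"

text \<open>The vectors have unit norm, so an eigenvalue equals its Rayleigh quotient
  \<open>bform A K u u\<close>; no separate list of eigenvalues is carried along.\<close>

definition eigfam :: "'a set \<Rightarrow> ('a \<Rightarrow> 'a \<Rightarrow> real) \<Rightarrow> ('a \<Rightarrow> real) set \<Rightarrow> bool" where
  "eigfam A K U \<longleftrightarrow> orthonormal_in A U \<and>
     (\<forall>u\<in>U. \<forall>x\<in>A. (\<Sum>y\<in>A. K x y * u y) = bform A K u u * u x)"

abbreviation lincomb :: "('a \<Rightarrow> real) set \<Rightarrow> (('a \<Rightarrow> real) \<Rightarrow> real) \<Rightarrow> 'a \<Rightarrow> real" where
  "lincomb U c \<equiv> (\<lambda>z. \<Sum>u\<in>U. c u * u z)"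

lemma ip_commute: "ip A f g = ip A g f"
  by (simp add: ip_def mult.commute)

lemma bform_commute: "finite A \<Longrightarrow> sym_on A K \<Longrightarrow> bform A K f g = bform A K g f"
  unfolding bform_def sum_distrib_left
  by (subst sum.swap, intro sum.cong refl) (auto simp: sym_on_def algebra_simps)

lemma ip_add_scale: "ip A (\<lambda>x. f x + t * g x) h = ip A f h + t * ip A g h"
  by (simp add: ip_def sum.distrib sum_distrib_left algebra_simps)

lemma ip_scale: "ip A (\<lambda>x. t * g x) h = t * ip A g h"
  by (simp add: ip_def sum_distrib_left algebra_simps)

lemma bform_add_scale_left: "bform A K (\<lambda>x. f x + t * g x) h = bform A K f h + t * bform A K g h"
  by (simp add: bform_def sum.distrib sum_distrib_left algebra_simps)

lemma bform_add_scale_right: "bform A K h (\<lambda>x. f x + t * g x) = bform A K h f + t * bform A K h g"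
  by (simp add: bform_def sum.distrib sum_distrib_left algebra_simps)

lemma bform_scale: "bform A K (\<lambda>x. t * f x) (\<lambda>x. t * f x) = t\<^sup>2 * bform A K f f"
  by (simp add: bform_def sum_distrib_left power2_eq_square algebra_simps)

lemma ip_lincomb: "ip A (lincomb U c) h = (\<Sum>u\<in>U. c u * ip A u h)"
  unfolding ip_def sum_distrib_left sum_distrib_right
  by (subst sum.swap) (simp add: algebra_simps)

lemma ip_nonneg: "ip A f f \<ge> 0"
  by (simp add: ip_def sum_nonneg)

lemma ip_eq_0_iff: "finite A \<Longrightarrow> ip A f f = 0 \<longleftrightarrow> (\<forall>x\<in>A. f x = 0)"
  by (simp add: ip_def sum_nonneg_eq_0_iff)

lemma supp_in_lincomb: "\<forall>u\<in>U. supp_in A u \<Longrightarrow> supp_in A (lincomb U c)"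
  by (auto simp: supp_in_def intro!: sum.neutral)

text \<open>For small \<open>t\<close> of the sign of \<open>b\<close> the linear term wins. The
  choice \<open>t = b / d\<close> with \<open>d > c\<close> covers every sign of
  \<open>c\<close>.\<close>

lemma linear_le_quadratic_imp_0:
  fixes b c :: real
  assumes "\<And>t. t * b \<le> t\<^sup>2 * c"
  shows "b = 0"
proof (rule ccontr)
  assume b: "b \<noteq> 0"
  define d where "d = \<bar>c\<bar> + 1"
  have d: "d > 0" "c < d" by (auto simp: d_def)
  have "(b / d) * b \<le> (b / d)\<^sup>2 * c" by (rule assms)
  also have "\<dots> < (b / d)\<^sup>2 * d" using b d by (intro mult_strict_left_mono) auto
  also have "\<dots> = (b / d) * b" using d by (simp add: power2_eq_square)
  finally show False by simp
qed

text \<open>Functions carry the topology of pointwise convergence, and their domain may be infinite.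
  Pinning the coordinates off \<open>A\<close> to zero leaves a product of compact sets, to which
  Tychonoff applies; this cube contains the unit sphere of l^2(A).\<close>

lemma compact_unit_ball_supp:
  fixes A :: "'a set"
  shows "compact {u :: 'a \<Rightarrow> real. \<forall>x. u x \<in> (if x \<in> A then {-1..1} else {0})}"
proof -
  let ?S = "\<lambda>x. if x \<in> A then {-1..1::real} else {0}"
  have "compactin (product_topology (\<lambda>_. euclidean) UNIV) (PiE UNIV ?S)"
    unfolding compactin_PiE by (auto simp: compactin_euclidean_iff)
  then have "compact (PiE UNIV ?S)"
    by (simp add: euclidean_product_topology compactin_euclidean_iff)
  also have "PiE UNIV ?S = {u. \<forall>x. u x \<in> ?S x}" by (auto simp: PiE_def Pi_def)
  finally show ?thesis .
qed

lemma exists_unit_orthogonal: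
  assumes "finite A" "finite U" "card U < card A"
  obtains u where "supp_in A u" "ip A u u = 1" "\<forall>w\<in>U. ip A u w = 0"
proof -
  obtain c where c: "\<exists>x\<in>A. c x \<noteq> 0" "\<forall>w\<in>U. (\<Sum>x\<in>A. w x * c x) = 0"
    using underdetermined_system[OF assms(2,1,3), of "\<lambda>w x. w x"] by blast
  define f where "f = (\<lambda>x. if x \<in> A then c x else 0)"
  have f: "\<forall>w\<in>U. ip A f w = 0" using c(2) by (simp add: ip_def f_def mult.commute cong: sum.cong)
  have "ip A f f \<noteq> 0" using c(1) assms(1) by (auto simp: ip_eq_0_iff f_def)
  then have pos: "ip A f f > 0" using ip_nonneg[of A f] by simp
  define t where "t = 1 / sqrt (ip A f f)"
  have t: "t * t * ip A f f = 1" using pos by (simp add: t_def)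
  show thesis
  proof
    show "supp_in A (\<lambda>x. t * f x)" by (simp add: supp_in_def f_def)
    have "ip A (\<lambda>x. t * f x) (\<lambda>x. t * f x) = t * (t * ip A f f)"
      by (subst ip_scale, subst ip_commute, subst ip_scale, simp)
    then show "ip A (\<lambda>x. t * f x) (\<lambda>x. t * f x) = 1" using t by simp
    show "\<forall>w\<in>U. ip A (\<lambda>x. t * f x) w = 0" using f by (simp add: ip_scale)
  qed
qed

text \<open>The maximiser of the form on the unit sphere of the orthogonal complement of \<open>U\<close> is an
  eigenvector.\<close>

lemma exists_next_eigenvector:
  assumes A: "finite A" and K: "sym_on A K" and U: "eigfam A K U" and less: "card U < card A"
  obtains u where "supp_in A u" "ip A u u = 1" "\<forall>w\<in>U. ip A u w = 0"
    "\<forall>x\<in>A. (\<Sum>y\<in>A. K x y * u y) = bform A K u u * u x"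
proof -
  define W where "W = {u. supp_in A u \<and> (\<forall>w\<in>U. ip A u w = 0)}"
  define S where "S = {u \<in> W. ip A u u = 1}"
  have finU: "finite U" using U by (simp add: eigfam_def orthonormal_in_def)
  have S_ne: "S \<noteq> {}"
  proof -
    obtain u where "supp_in A u" "ip A u u = 1" "\<forall>w\<in>U. ip A u w = 0"
      using exists_unit_orthogonal[OF A finU less] .
    then have "u \<in> S" by (simp add: S_def W_def)
    then show ?thesis by blast
  qed
  have ci: "continuous_on UNIV (\<lambda>u. ip A (F u) (G u))"
    if "\<And>x. continuous_on UNIV (\<lambda>u. F u x)" "\<And>x. continuous_on UNIV (\<lambda>u. G u x)"
    for F G :: "('a \<Rightarrow> real) \<Rightarrow> 'a \<Rightarrow> real"
    unfolding ip_def by (intro continuous_intros that)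
  have cl: "closed {u. supp_in A u \<and> (\<forall>w\<in>U. ip A u w = 0) \<and> ip A u u = 1}"
    unfolding supp_in_def Ball_def
    by (intro closed_Collect_conj closed_Collect_all closed_Collect_imp closed_Collect_eq
          open_Collect_const ci continuous_on_const) auto
  have "S \<subseteq> {u. \<forall>x. u x \<in> (if x \<in> A then {-1..1} else {0})}"
  proof clarify
    fix u x assume u: "u \<in> S"
    have "\<bar>u x\<bar> \<le> 1" if "x \<in> A"
    proof -
      have "u x * u x \<le> ip A u u"
        unfolding ip_def by (rule member_le_sum[OF that]) (use A in auto)
      then have "(u x)\<^sup>2 \<le> 1" using u by (simp add: S_def power2_eq_square)
      then show ?thesis by (simp add: abs_square_le_1)
    qed
    then show "u x \<in> (if x \<in> A then {-1..1} else {0})"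
      using u by (auto simp: S_def W_def supp_in_def abs_le_iff)
  qed
  moreover have "closed S"
    using cl by (simp add: S_def W_def conj_assoc)
  ultimately have "compact S"
    using compact_Int_closed[OF compact_unit_ball_supp[of A], of S] by (simp add: Int_absorb1)
  moreover have "continuous_on S (\<lambda>u. bform A K u u)"
    unfolding bform_def
    by (intro continuous_intros continuous_on_subset[OF continuous_on_product_coordinates]) auto
  ultimately obtain u where u: "u \<in> S" "\<And>w. w \<in> S \<Longrightarrow> bform A K w w \<le> bform A K u u"
    using S_ne continuous_attains_sup[of S] by blast
  define l where "l = bform A K u u"
  \<comment> \<open>Homogeneity carries the maximum from the unit sphere to all of \<open>W\<close>,
    where variations need not be normalised.\<close>
  have max: "bform A K w w \<le> l * ip A w w" if w: "w \<in> W" for w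
  proof (cases "ip A w w = 0")
    case True
    then have "bform A K w w = 0" using A by (simp add: ip_eq_0_iff bform_def)
    then show ?thesis using True by simp
  next
    case False
    then have pos: "ip A w w > 0" using ip_nonneg[of A w] by simp
    define t where "t = 1 / sqrt (ip A w w)"
    have t: "t\<^sup>2 = 1 / ip A w w" using pos by (simp add: t_def power_divide)
    have "ip A (\<lambda>x. t * w x) (\<lambda>x. t * w x) = t * (t * ip A w w)"
      by (subst ip_scale, subst ip_commute, subst ip_scale, simp)
    also have "\<dots> = 1" using t pos by (simp add: power2_eq_square field_simps)
    finally have "(\<lambda>x. t * w x) \<in> S"
      using w by (simp add: S_def W_def supp_in_def ip_scale)
    from u(2)[OF this] have "t\<^sup>2 * bform A K w w \<le> l" by (simp add: bform_scale l_def)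
    then show ?thesis using pos by (simp add: t field_simps)
  qed
  have uW: "supp_in A u" "\<forall>w\<in>U. ip A u w = 0" "ip A u u = 1"
    using u(1) by (auto simp: S_def W_def)
  have first_order: "bform A K w u = l * ip A w u" if w: "w \<in> W" for w
  proof -
    have "2 * (bform A K w u - l * ip A w u) = 0"
    proof (rule linear_le_quadratic_imp_0)
      fix t
      have "(\<lambda>x. u x + t * w x) \<in> W"
        using w uW by (simp add: W_def supp_in_def ip_add_scale)
      from max[OF this]
      have "bform A K u u + t * bform A K u w + t * (bform A K w u + t * bform A K w w)
         \<le> l * (ip A u u + t * ip A w u + t * (ip A u w + t * ip A w w))"
        unfolding bform_add_scale_left bform_add_scale_right ip_add_scale
        by (subst (asm) (1 2) ip_commute) (simp add: ip_add_scale algebra_simps)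
      moreover have "bform A K u w = bform A K w u" using A K by (rule bform_commute)
      ultimately show "t * (2 * (bform A K w u - l * ip A w u))
          \<le> t\<^sup>2 * (l * ip A w w - bform A K w w)"
        using uW(3) ip_commute[of A u w]
        by (simp add: l_def[symmetric] algebra_simps power2_eq_square)
    qed
    then show ?thesis by simp
  qed
  \<comment> \<open>The residual of the eigenvalue equation. Symmetry of \<open>K\<close> makes it
    orthogonal to \<open>U\<close>, so it is an admissible direction; the first-order condition
    tested on the residual itself says that its norm is zero.\<close>
  define w where "w = (\<lambda>x. if x \<in> A then (\<Sum>y\<in>A. K x y * u y) - l * u x else 0)"
  have ipw: "ip A h w = bform A K h u - l * ip A h u" for h
    by (simp add: ip_def bform_def w_def algebra_simps sum_subtractf sum_distrib_left cong: sum.cong)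
  have "ip A w v = 0" if v: "v \<in> U" for v
  proof -
    have "bform A K u v = (\<Sum>x\<in>A. u x * (bform A K v v * v x))"
      unfolding bform_def[of A K u v] using U v
      by (intro sum.cong refl) (auto simp: eigfam_def)
    also have "\<dots> = bform A K v v * ip A u v"
      by (simp add: ip_def sum_distrib_left algebra_simps)
    finally have "bform A K v u = 0" using v uW(2) bform_commute[OF A K, of u v] by simp
    then show ?thesis using ipw[of v] uW(2) v by (simp add: ip_commute)
  qed
  then have "w \<in> W" by (simp add: W_def supp_in_def w_def)
  then have "ip A w w = 0" using ipw[of w] first_order by simp
  then have "\<forall>x\<in>A. (\<Sum>y\<in>A. K x y * u y) = l * u x"
    using A by (simp add: ip_eq_0_iff w_def)
  then show thesis using that uW l_def by blast
qed

lemma exists_eigfam: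
  assumes A: "finite A" and K: "sym_on A K" and "k \<le> card A"
  shows "\<exists>U. eigfam A K U \<and> card U = k"
  using assms(3)
proof (induction k)
  case 0
  then show ?case by (intro exI[of _ "{}"]) (simp add: eigfam_def orthonormal_in_def)
next
  case (Suc k)
  then obtain U where U: "eigfam A K U" "card U = k" by auto
  obtain u where u: "supp_in A u" "ip A u u = 1" "\<forall>w\<in>U. ip A u w = 0"
    "\<forall>x\<in>A. (\<Sum>y\<in>A. K x y * u y) = bform A K u u * u x"
    using exists_next_eigenvector[OF A K U(1)] U(2) Suc.prems by auto
  have "u \<notin> U" using u(2,3) by auto
  then have "card (insert u U) = Suc k"
    using U by (simp add: eigfam_def orthonormal_in_def)
  moreover have "eigfam A K (insert u U)"
  proof -
    have "\<forall>w\<in>U. ip A w u = 0" using u(3) by (simp add: ip_commute[of A _ u])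
    then show ?thesis
      using U(1) u \<open>u \<notin> U\<close> unfolding eigfam_def orthonormal_in_def by simp blast
  qed
  ultimately show ?case by blast
qed

section \<open>Eigenbases and Parseval expansion\<close>

definition eigbasis :: "'a set \<Rightarrow> ('a \<Rightarrow> 'a \<Rightarrow> real) \<Rightarrow> ('a \<Rightarrow> real) set \<Rightarrow> bool" where
  "eigbasis A K U \<longleftrightarrow> eigfam A K U \<and> card U = card A"

lemma exists_eigbasis: "finite A \<Longrightarrow> sym_on A K \<Longrightarrow> \<exists>U. eigbasis A K U"
  using exists_eigfam[of A K "card A"] by (simp add: eigbasis_def)

lemma ip_lincomb_basis:
  assumes "orthonormal_in A U" "u \<in> U"
  shows "ip A (lincomb U c) u = c u"
proof -
  have "ip A (lincomb U c) u = (\<Sum>v\<in>U. if v = u then c v else 0)"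
    unfolding ip_lincomb using assms by (intro sum.cong) (auto simp: orthonormal_in_def)
  then show ?thesis using assms by (simp add: orthonormal_in_def)
qed

text \<open>Otherwise \<open>y\<close> and \<open>U\<close> would be \<open>card A + 1\<close>
  functions on \<open>A\<close>, hence linearly dependent there; pairing the relation with
  \<open>y\<close> and with each member of \<open>U\<close> kills all coefficients.\<close>

lemma orthonormal_complete:
  assumes A: "finite A" and U: "orthonormal_in A U" "card U = card A"
    and y: "\<forall>u\<in>U. ip A y u = 0"
  shows "\<forall>x\<in>A. y x = 0"
proof (rule ccontr)
  assume "\<not> ?thesis"
  then have yy: "ip A y y \<noteq> 0" using A by (simp add: ip_eq_0_iff)
  have yU: "y \<notin> U" using y yy by auto
  have fin: "finite U" using U by (simp add: orthonormal_in_def)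
  obtain c where c: "\<exists>i\<in>insert y U. c i \<noteq> 0"
    "\<forall>x\<in>A. (\<Sum>i\<in>insert y U. i x * c i) = 0"
    using underdetermined_system[OF A, of "insert y U" "\<lambda>x i. i x"] fin yU U(2) by auto
  have "(\<Sum>i\<in>insert y U. c i * ip A i h) = 0" for h
  proof -
    have "(\<Sum>i\<in>insert y U. c i * ip A i h) = ip A (lincomb (insert y U) c) h"
      by (rule ip_lincomb[symmetric])
    also have "\<dots> = 0" unfolding ip_def using c(2) by (intro sum.neutral) (simp add: mult.commute)
    finally show ?thesis .
  qed
  then have eq: "c y * ip A y h + (\<Sum>i\<in>U. c i * ip A i h) = 0" for h using fin yU by simp
  have "(\<Sum>i\<in>U. c i * ip A i y) = 0" using y by (intro sum.neutral) (simp add: ip_commute)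
  then have cy: "c y = 0" using eq[of y] yy by simp
  have "c u = 0" if u: "u \<in> U" for u
    using eq[of u] cy ip_lincomb_basis[OF U(1) u, of c] by (simp add: ip_lincomb)
  then show False using c(1) cy by auto
qed

lemma bform_lincomb_eig:
  assumes U: "eigfam A K U"
  shows "bform A K f (lincomb U c) = (\<Sum>u\<in>U. c u * bform A K u u * ip A f u)"
proof -
  have "(\<Sum>y\<in>A. K x y * lincomb U c y) = (\<Sum>u\<in>U. c u * (bform A K u u * u x))"
    if x: "x \<in> A" for x
  proof -
    have "(\<Sum>y\<in>A. K x y * lincomb U c y) = (\<Sum>u\<in>U. c u * (\<Sum>y\<in>A. K x y * u y))"
      unfolding sum_distrib_left by (subst sum.swap) (simp add: algebra_simps)
    also have "\<dots> = (\<Sum>u\<in>U. c u * (bform A K u u * u x))"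
      using U x by (intro sum.cong) (auto simp: eigfam_def)
    finally show ?thesis .
  qed
  then have "bform A K f (lincomb U c) = (\<Sum>x\<in>A. \<Sum>u\<in>U. c u * bform A K u u * (f x * u x))"
    unfolding bform_def[of A K f "lincomb U c"]
    by (simp add: sum_distrib_left algebra_simps cong: sum.cong)
  then show ?thesis by (subst (asm) sum.swap) (simp add: ip_def sum_distrib_left)
qed

text \<open>The difference between \<open>f\<close> and its Fourier sum is orthogonal to
  \<open>U\<close>, hence zero on \<open>A\<close>. What follows is Parseval's identity and the
  diagonal form of \<open>bform\<close>.\<close>

lemma eigbasis_expand:
  assumes A: "finite A" and U: "eigbasis A K U"
  shows "ip A f f = (\<Sum>u\<in>U. (ip A f u)\<^sup>2)"
    and "bform A K f f = (\<Sum>u\<in>U. bform A K u u * (ip A f u)\<^sup>2)"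
proof -
  have on: "orthonormal_in A U" "card U = card A" "eigfam A K U"
    using U by (auto simp: eigbasis_def eigfam_def)
  let ?g = "lincomb U (ip A f)"
  have "\<forall>u\<in>U. ip A (\<lambda>x. f x + (-1) * ?g x) u = 0"
    unfolding ip_add_scale using ip_lincomb_basis[OF on(1)] by simp
  from orthonormal_complete[OF A on(1,2) this] have eq: "\<forall>x\<in>A. f x = ?g x" by simp
  then have "ip A f f = ip A ?g f" by (simp add: ip_def cong: sum.cong)
  also have "\<dots> = (\<Sum>u\<in>U. ip A f u * ip A u f)" by (rule ip_lincomb)
  also have "\<dots> = (\<Sum>u\<in>U. (ip A f u)\<^sup>2)"
    by (intro sum.cong refl) (simp add: power2_eq_square ip_commute)
  finally show "ip A f f = (\<Sum>u\<in>U. (ip A f u)\<^sup>2)" .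
  have "bform A K f f = bform A K f ?g" using eq by (simp add: bform_def cong: sum.cong)
  also have "\<dots> = (\<Sum>u\<in>U. bform A K u u * (ip A f u)\<^sup>2)"
    unfolding bform_lincomb_eig[OF on(3)]
    by (intro sum.cong refl) (simp add: power2_eq_square)
  finally show "bform A K f f = (\<Sum>u\<in>U. bform A K u u * (ip A f u)\<^sup>2)" .
qed

section \<open>Spectral subspaces and the min-max principle\<close>

text \<open>For an eigenbasis these vectors span the spectral subspace of (-infinity, E], so their
  number counts eigenvalues with multiplicity.\<close>

definition low_modes :: "real \<Rightarrow> 'a set \<Rightarrow> ('a \<Rightarrow> 'a \<Rightarrow> real) \<Rightarrow> ('a \<Rightarrow> real) set \<Rightarrow> ('a \<Rightarrow> real) set" where
  "low_modes E A K U = {u \<in> U. bform A K u u \<le> E}"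

lemma form_le_on_low_modes:
  assumes A: "finite A" and U: "eigfam A K U" and c: "\<And>u. u \<in> U \<Longrightarrow> bform A K u u > E \<Longrightarrow> c u = 0"
  shows "bform A K (lincomb U c) (lincomb U c) \<le> E * ip A (lincomb U c) (lincomb U c)"
proof -
  have on: "orthonormal_in A U" using U by (simp add: eigfam_def)
  have *: "ip A (lincomb U c) u = c u" if "u \<in> U" for u using ip_lincomb_basis[OF on that] .
  have "bform A K (lincomb U c) (lincomb U c) = (\<Sum>u\<in>U. bform A K u u * (c u)\<^sup>2)"
    unfolding bform_lincomb_eig[OF U] using * by (simp add: power2_eq_square algebra_simps)
  also have "\<dots> \<le> (\<Sum>u\<in>U. E * (c u)\<^sup>2)"
  proof (rule sum_mono)
    fix u assume u: "u \<in> U"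
    show "bform A K u u * (c u)\<^sup>2 \<le> E * (c u)\<^sup>2"
      using c[OF u] by (cases "bform A K u u > E") (auto intro: mult_right_mono)
  qed
  also have "\<dots> = E * ip A (lincomb U c) (lincomb U c)"
    unfolding ip_lincomb using *
    by (simp add: sum_distrib_left power2_eq_square ip_commute[of A _ "lincomb U c"])
  finally show ?thesis .
qed

lemma form_gt_off_low_modes:
  assumes A: "finite A" and U: "eigbasis A K U"
    and f: "\<forall>u\<in>low_modes E A K U. ip A f u = 0" and nz: "\<exists>x\<in>A. f x \<noteq> 0"
  shows "bform A K f f > E * ip A f f"
proof -
  have fin: "finite U" using U by (simp add: eigbasis_def eigfam_def orthonormal_in_def)
  have f0: "ip A f f \<noteq> 0" using nz A by (simp add: ip_eq_0_iff)
  then obtain u where u: "u \<in> U" "ip A f u \<noteq> 0"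
    unfolding eigbasis_expand(1)[OF A U] by (metis (no_types, lifting) sum.neutral zero_eq_power2)
  have "(\<Sum>u\<in>U. E * (ip A f u)\<^sup>2) < (\<Sum>u\<in>U. bform A K u u * (ip A f u)\<^sup>2)"
  proof (rule sum_strict_mono_ex1[OF fin])
    show "\<forall>u\<in>U. E * (ip A f u)\<^sup>2 \<le> bform A K u u * (ip A f u)\<^sup>2"
    proof
      fix u assume "u \<in> U"
      then show "E * (ip A f u)\<^sup>2 \<le> bform A K u u * (ip A f u)\<^sup>2"
        using f by (cases "bform A K u u \<le> E") (auto simp: low_modes_def intro: mult_right_mono)
    qed
    have "bform A K u u > E" using f u by (auto simp: low_modes_def)
    then show "\<exists>u\<in>U. E * (ip A f u)\<^sup>2 < bform A K u u * (ip A f u)\<^sup>2"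
      using u by (intro bexI[of _ u]) auto
  qed
  then show ?thesis unfolding eigbasis_expand[OF A U, of f] by (simp add: sum_distrib_left)
qed

text \<open>The two halves of the Courant--Fischer principle.\<close>

lemma card_le_low_modes:
  assumes A: "finite A" and U: "eigbasis A K U" and W: "orthonormal_in A W"
    and le: "\<And>c. bform A K (lincomb W c) (lincomb W c) \<le> E * ip A (lincomb W c) (lincomb W c)"
  shows "card W \<le> card (low_modes E A K U)"
proof (rule ccontr)
  assume less: "\<not> ?thesis"
  have fin: "finite W" "finite (low_modes E A K U)"
    using U W by (auto simp: eigbasis_def eigfam_def orthonormal_in_def low_modes_def)
  \<comment> \<open>Fewer conditions than unknowns: some nontrivial combination of \<open>W\<close>
    is orthogonal to every low mode, and there the form exceeds \<open>E\<close>.\<close>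
  obtain c where c: "\<exists>w\<in>W. c w \<noteq> 0"
      "\<forall>u\<in>low_modes E A K U. (\<Sum>w\<in>W. ip A w u * c w) = 0"
    using underdetermined_system[OF fin(2,1), of "\<lambda>u w. ip A w u"] less by auto
  have "\<exists>x\<in>A. lincomb W c x \<noteq> 0"
  proof (rule ccontr)
    assume "\<not> ?thesis"
    then have "ip A (lincomb W c) w = 0" for w by (simp add: ip_def)
    moreover obtain w where "w \<in> W" "c w \<noteq> 0" using c(1) by blast
    ultimately show False using ip_lincomb_basis[OF W, of w c] by simp
  qed
  moreover have "\<forall>u\<in>low_modes E A K U. ip A (lincomb W c) u = 0"
    using c(2) unfolding ip_lincomb by (simp add: mult.commute)
  ultimately show False using form_gt_off_low_modes[OF A U, of E "lincomb W c"] le[of c] by simp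
qed

lemma low_modes_le_card:
  assumes A: "finite A" and U: "eigbasis A K U" and F: "finite F"
    and gt: "\<And>f. supp_in A f \<Longrightarrow> \<exists>x\<in>A. f x \<noteq> 0 \<Longrightarrow> \<forall>g\<in>F. ip A f g = 0 \<Longrightarrow>
      bform A K f f > E * ip A f f"
  shows "card (low_modes E A K U) \<le> card F"
proof (rule ccontr)
  assume less: "\<not> ?thesis"
  have eig: "eigfam A K U" and on: "orthonormal_in A U" and fin: "finite U"
    using U by (auto simp: eigbasis_def eigfam_def orthonormal_in_def)
  let ?L = "low_modes E A K U"
  have LU: "?L \<subseteq> U" by (auto simp: low_modes_def)
  obtain c0 where c0: "\<exists>u\<in>?L. c0 u \<noteq> 0" "\<forall>g\<in>F. (\<Sum>u\<in>?L. ip A u g * c0 u) = 0"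
    using underdetermined_system[OF F finite_subset[OF LU fin], of "\<lambda>g u. ip A u g"] less by auto
  define c where "c = (\<lambda>u. if u \<in> ?L then c0 u else 0)"
  have "ip A (lincomb U c) g = (\<Sum>u\<in>?L. ip A u g * c0 u)" for g
    unfolding ip_lincomb using fin LU
    by (intro sum.mono_neutral_cong_right) (auto simp: c_def)
  then have orth: "\<forall>g\<in>F. ip A (lincomb U c) g = 0" using c0(2) by simp
  have "\<exists>x\<in>A. lincomb U c x \<noteq> 0"
  proof (rule ccontr)
    assume "\<not> ?thesis"
    then have "ip A (lincomb U c) w = 0" for w by (simp add: ip_def)
    moreover obtain u where "u \<in> ?L" "c0 u \<noteq> 0" using c0(1) by blast
    ultimately show False using ip_lincomb_basis[OF on, of u c] LU by (auto simp: c_def)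
  qed
  then have "bform A K (lincomb U c) (lincomb U c) > E * ip A (lincomb U c) (lincomb U c)"
    using gt[OF supp_in_lincomb _ orth] on by (auto simp: orthonormal_in_def)
  moreover have "bform A K (lincomb U c) (lincomb U c) \<le> E * ip A (lincomb U c) (lincomb U c)"
    by (rule form_le_on_low_modes[OF A eig]) (auto simp: c_def low_modes_def)
  ultimately show False by simp
qed

subsection \<open>Counting eigenvalues\<close>

lemma order_prod_linear:
  "Polynomial.order r (\<Prod>a\<leftarrow>as. [:- a, 1 :: real:]) = count_list as r"
proof (induction as)
  case (Cons a as)
  have nz: "(\<Prod>a\<leftarrow>as. [:- a, 1 :: real:]) \<noteq> 0" by (auto simp: prod_list_zero_iff)
  have "Polynomial.order r [:- a, 1:] = (if a = r then 1 else 0)"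
    using order_power_n_n[of r 1] by (auto simp: order_0I)
  moreover have "Polynomial.order r ([:- a, 1:] * (\<Prod>a\<leftarrow>as. [:- a, 1:]))
      = Polynomial.order r [:- a, 1:] + Polynomial.order r (\<Prod>a\<leftarrow>as. [:- a, 1:])"
    by (rule order_mult) (use nz in \<open>simp del: mult_pCons_left\<close>)
  ultimately show ?case using Cons by (simp del: mult_pCons_left)
qed simp

lemma poly_prod_linear_eq_0_iff:
  "poly (\<Prod>a\<leftarrow>as. [:- a, 1 :: real:]) r = 0 \<longleftrightarrow> r \<in> set as"
  by (induction as) auto

lemma ev_count_linear_factors:
  assumes "char_poly X = (\<Prod>a\<leftarrow>as. [:- a, 1:])"
  shows "ev_count E X = length (filter (\<lambda>a. a \<le> E) as)"
proof -
  have roots: "{r. r \<le> E \<and> poly (char_poly X) r = 0} = set (filter (\<lambda>a. a \<le> E) as)"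
    unfolding assms poly_prod_linear_eq_0_iff by auto
  have "ev_count E X = (\<Sum>r\<in>set (filter (\<lambda>a. a \<le> E) as). count_list (filter (\<lambda>a. a \<le> E) as) r)"
    unfolding ev_count_def roots unfolding assms order_prod_linear
    by (intro sum.cong refl) (auto simp: count_list_eq_length_filter intro!: arg_cong[of _ _ length] filter_cong)
  also have "\<dots> = length (filter (\<lambda>a. a \<le> E) as)" by (rule sum_count_set) auto
  finally show ?thesis .
qed

lemma sum_set_nth:
  assumes "distinct xs"
  shows "(\<Sum>x\<in>set xs. f x) = (\<Sum>i=0..<length xs. f (xs ! i))"
  using assms by (simp add: sum_list_distinct_conv_sum_set[symmetric] sum_list_sum_nth)

text \<open>The columns of \<open>P\<close> are the eigenvectors and \<open>Q\<close> is its
  transpose. Orthonormality is \<open>Q * P = 1\<close>, which for square matrices gives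
  \<open>P * Q = 1\<close>; so the matrix is similar to the diagonal matrix of eigenvalues, and root
  orders of the characteristic polynomial become repetitions on that diagonal.\<close>

lemma ev_count_eigbasis:
  assumes xs: "distinct xs" and U: "eigbasis (set xs) K U"
  shows "ev_count E (Matrix.mat (length xs) (length xs) (\<lambda>(i, j). K (xs ! i) (xs ! j)))
    = card (low_modes E (set xs) K U)"
proof -
  define n where "n = length xs"
  let ?A = "set xs"
  have on: "orthonormal_in ?A U" and fin: "finite U" and card: "card U = n"
    and eig: "\<And>u x. u \<in> U \<Longrightarrow> x \<in> ?A \<Longrightarrow> (\<Sum>y\<in>?A. K x y * u y) = bform ?A K u u * u x"
    using U distinct_card[OF xs] by (auto simp: eigbasis_def eigfam_def orthonormal_in_def n_def)
  obtain us where us: "set us = U" "distinct us" using finite_distinct_list[OF fin] by blast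
  then have len: "length us = n" using card distinct_card[of us] by simp
  define lam where "lam = (\<lambda>u. bform ?A K u u)"
  define X where "X = Matrix.mat n n (\<lambda>(i, j). K (xs ! i) (xs ! j))"
  define P where "P = Matrix.mat n n (\<lambda>(i, j). (us ! j) (xs ! i))"
  define Q where "Q = Matrix.mat n n (\<lambda>(i, j). (us ! i) (xs ! j))"
  define D where "D = Matrix.mat n n (\<lambda>(i, j). if i = j then lam (us ! i) else 0)"
  have carr: "X \<in> carrier_mat n n" "P \<in> carrier_mat n n" "Q \<in> carrier_mat n n" "D \<in> carrier_mat n n"
    by (auto simp: X_def P_def Q_def D_def)
  have mem: "us ! i \<in> U" if "i < n" for i using that us len by auto
  have QP: "Q * P = 1\<^sub>m n"
  proof (rule eq_matI)
    fix i j assume ij: "i < dim_row (1\<^sub>m n)" "j < dim_col (1\<^sub>m n)"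
    then have "(Q * P) $$ (i, j) = (\<Sum>k=0..<n. (us ! i) (xs ! k) * (us ! j) (xs ! k))"
      by (simp add: Q_def P_def scalar_prod_def)
    also have "\<dots> = ip ?A (us ! i) (us ! j)" by (simp add: ip_def sum_set_nth[OF xs] n_def)
    also have "\<dots> = (if us ! i = us ! j then 1 else 0)"
      using on mem ij by (simp add: orthonormal_in_def)
    also have "\<dots> = 1\<^sub>m n $$ (i, j)"
      using ij us(2) len by (simp add: nth_eq_iff_index_eq)
    finally show "(Q * P) $$ (i, j) = 1\<^sub>m n $$ (i, j)" .
  qed (simp_all add: Q_def P_def)
  have PQ: "P * Q = 1\<^sub>m n" by (rule mat_mult_left_right_inverse[OF carr(3,2) QP])
  have XP: "X * P = P * D"
  proof (rule eq_matI)
    fix i j assume "i < dim_row (P * D)" "j < dim_col (P * D)"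
    then have ij: "i < n" "j < n" by (auto simp: P_def D_def)
    then have "(X * P) $$ (i, j) = (\<Sum>k=0..<n. K (xs ! i) (xs ! k) * (us ! j) (xs ! k))"
      by (simp add: X_def P_def scalar_prod_def)
    also have "\<dots> = (\<Sum>y\<in>?A. K (xs ! i) y * (us ! j) y)" by (simp add: sum_set_nth[OF xs] n_def)
    also have "\<dots> = lam (us ! j) * (us ! j) (xs ! i)"
      using ij mem by (subst eig) (auto simp: n_def lam_def)
    also have "\<dots> = (\<Sum>k=0..<n. (us ! k) (xs ! i) * (if k = j then lam (us ! k) else 0))"
      using ij by (simp add: if_distrib cong: if_cong)
    also have "\<dots> = (P * D) $$ (i, j)" using ij by (simp add: P_def D_def scalar_prod_def)
    finally show "(X * P) $$ (i, j) = (P * D) $$ (i, j)" .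
  qed (simp_all add: X_def P_def D_def)
  have "X = X * (P * Q)" using carr by (simp add: PQ)
  also have "\<dots> = P * D * Q" using carr by (simp add: XP assoc_mult_mat[symmetric, of X n n P n Q n])
  finally have "similar_mat X D"
    unfolding similar_mat_def using similar_mat_witI[OF PQ QP _ carr(1,4,2,3)] by blast
  then have "char_poly X = char_poly D" by (rule char_poly_similar)
  also have "\<dots> = (\<Prod>a\<leftarrow>diag_mat D. [:- a, 1:])"
    by (rule char_poly_upper_triangular[OF carr(4)]) (auto simp: D_def)
  also have "diag_mat D = map lam us"
    by (rule nth_equalityI) (auto simp: diag_mat_def D_def len)
  finally have "ev_count E X = length (filter (\<lambda>a. a \<le> E) (map lam us))"
    by (rule ev_count_linear_factors)
  also have "\<dots> = card (set (filter (\<lambda>u. lam u \<le> E) us))"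
    using us(2) by (subst distinct_card) (auto simp: filter_map o_def)
  also have "set (filter (\<lambda>u. lam u \<le> E) us) = low_modes E ?A K U"
    using us(1) by (auto simp: low_modes_def lam_def)
  finally show ?thesis by (simp add: X_def n_def)
qed

text \<open>\<open>Ncount\<close> ties the boundary condition to the set. Here a fixed kernel can be
  restricted to many sets, as interlacing requires.\<close>

abbreviation Nev :: "real \<Rightarrow> 'a set \<Rightarrow> ('a \<Rightarrow> 'a \<Rightarrow> real) \<Rightarrow> nat" where
  "Nev E A K \<equiv> ev_count E (op_matrix A K)"

lemma op_matrix_listing:
  assumes "finite A"
  obtains xs where "distinct xs" "set xs = A"
    "op_matrix A K = Matrix.mat (length xs) (length xs) (\<lambda>(i, j). K (xs ! i) (xs ! j))"
proof -
  define xs where "xs = (SOME xs. distinct xs \<and> set xs = A)"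
  have xs: "distinct xs \<and> set xs = A"
    unfolding xs_def by (rule someI_ex) (use finite_distinct_list[OF assms] in blast)
  then have "card A = length xs" using distinct_card by blast
  then show thesis using that[of xs] xs by (simp add: op_matrix_def xs_def[symmetric])
qed

lemma Nev_eq_low_modes:
  assumes "finite A" "eigbasis A K U"
  shows "Nev E A K = card (low_modes E A K U)"
  using op_matrix_listing[OF assms(1), of K] ev_count_eigbasis assms(2) by metis

text \<open>Both listings lead to the number of low modes of one eigenbasis, which refers to no
  listing. This frees the count from the \<open>SOME\<close> in \<open>op_matrix\<close>, so that a
  listing of \<open>A\<close> can be transported along a map.\<close>

lemma Nev_listing:
  assumes "distinct xs" "sym_on (set xs) K"
  shows "Nev E (set xs) K = ev_count E (Matrix.mat (length xs) (length xs) (\<lambda>(i, j). K (xs ! i) (xs ! j)))"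
proof -
  obtain U where "eigbasis (set xs) K U" using exists_eigbasis assms by blast
  then show ?thesis using Nev_eq_low_modes[of "set xs"] ev_count_eigbasis[OF assms(1)] by simp
qed

lemma Nev_cong:
  assumes "finite A" "\<And>x y. x \<in> A \<Longrightarrow> y \<in> A \<Longrightarrow> K x y = K' x y"
  shows "Nev E A K = Nev E A K'"
proof -
  obtain xs where xs: "distinct xs" "set xs = A" "xs = (SOME xs. distinct xs \<and> set xs = A)"
    using someI_ex[of "\<lambda>xs. distinct xs \<and> set xs = A"] finite_distinct_list[OF assms(1)] by blast
  have mem: "xs ! i \<in> A" if "i < card A" for i using that xs(2) distinct_card[OF xs(1)] by auto
  have "op_matrix A K = op_matrix A K'"
    unfolding op_matrix_def Let_def xs(3)[symmetric]
    by (intro eq_matI) (auto intro: assms(2) mem)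
  then show ?thesis by simp
qed

lemma Nev_image:
  assumes A: "finite A" and g: "inj_on g A" and K: "sym_on (g ` A) K"
  shows "Nev E (g ` A) K = Nev E A (\<lambda>x y. K (g x) (g y))"
proof -
  obtain xs where xs: "distinct xs" "set xs = A" using finite_distinct_list[OF A] by blast
  have "distinct (map g xs)" using xs g by (simp add: distinct_map)
  from Nev_listing[OF this, of K E] K xs(2)
  have "Nev E (g ` A) K = ev_count E (Matrix.mat (length xs) (length xs)
      (\<lambda>(i, j). K (map g xs ! i) (map g xs ! j)))" by simp
  also have "Matrix.mat (length xs) (length xs) (\<lambda>(i, j). K (map g xs ! i) (map g xs ! j))
      = Matrix.mat (length xs) (length xs) (\<lambda>(i, j). K (g (xs ! i)) (g (xs ! j)))"
    by (intro eq_matI) auto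
  also have "ev_count E \<dots> = Nev E A (\<lambda>x y. K (g x) (g y))"
    using Nev_listing[OF xs(1), of "\<lambda>x y. K (g x) (g y)" E] K xs(2) by (simp add: sym_on_def)
  finally show ?thesis .
qed

lemma Nev_le_card:
  assumes "finite A" "sym_on A K"
  shows "Nev E A K \<le> card A"
proof -
  obtain U where U: "eigbasis A K U" using exists_eigbasis assms by blast
  then have "finite U" "card U = card A" by (auto simp: eigbasis_def eigfam_def orthonormal_in_def)
  then show ?thesis
    using Nev_eq_low_modes[OF assms(1) U] card_mono[of U "low_modes E A K U"]
    by (auto simp: low_modes_def)
qed

section \<open>Cauchy interlacing and decoupling\<close>

lemma ip_mono_supp:
  assumes "finite A" "C \<subseteq> A" "supp_in C f"
  shows "ip A f g = ip C f g"
  unfolding ip_def using assms by (intro sum.mono_neutral_right) (auto simp: supp_in_def)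

lemma bform_mono_supp:
  assumes "finite A" "C \<subseteq> A" "supp_in C f" "supp_in C g"
  shows "bform A K f g = bform C K f g"
proof -
  have "(\<Sum>y\<in>A. K x y * g y) = (\<Sum>y\<in>C. K x y * g y)" for x
    using assms by (intro sum.mono_neutral_right) (auto simp: supp_in_def)
  then show ?thesis
    unfolding bform_def using assms by (simp, intro sum.mono_neutral_right) (auto simp: supp_in_def)
qed

lemma orthonormal_in_mono:
  assumes "finite A" "C \<subseteq> A" "orthonormal_in C W"
  shows "orthonormal_in A W"
  unfolding orthonormal_in_def
proof (intro conjI ballI)
  have W: "finite W" "\<And>u. u \<in> W \<Longrightarrow> supp_in C u"
    "\<And>u w. u \<in> W \<Longrightarrow> w \<in> W \<Longrightarrow> ip C u w = (if u = w then 1 else 0)"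
    using assms(3) by (auto simp: orthonormal_in_def)
  show "finite W" by fact
  show "supp_in A u" if "u \<in> W" for u using W(2)[OF that] assms(2) by (auto simp: supp_in_def)
  show "ip A u w = (if u = w then 1 else 0)" if "u \<in> W" "w \<in> W" for u w
    using W(3)[OF that] ip_mono_supp[OF assms(1,2) W(2)[OF that(1)], of w] by simp
qed

text \<open>Lower bound: the low modes of \<open>C\<close>, extended by zero, span a space on which
  the form over \<open>A\<close> is at most \<open>E\<close> times the squared norm. Upper bound: a
  nonzero function orthogonal to these modes and to the point masses on \<open>A - C\<close> lives
  on \<open>C\<close>, where its form exceeds that bound, so \<open>A\<close> has no more low modes
  than there are such conditions.\<close>

lemma interlacing:
  assumes A: "finite A" and CA: "C \<subseteq> A" and K: "sym_on A K"
  shows "Nev E C K \<le> Nev E A K" and "Nev E A K \<le> Nev E C K + card (A - C)"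
proof -
  have C: "finite C" "sym_on C K" using finite_subset[OF CA A] K CA by (auto simp: sym_on_def)
  obtain U where U: "eigbasis A K U" using exists_eigbasis A K by blast
  obtain W where W: "eigbasis C K W" using exists_eigbasis C by blast
  have eigW: "eigfam C K W" and onW: "orthonormal_in C W" and finW: "finite W"
    using W by (auto simp: eigbasis_def eigfam_def orthonormal_in_def)
  let ?L = "low_modes E C K W"
  have L: "?L \<subseteq> W" "finite ?L" using finW by (auto simp: low_modes_def)
  have eigL: "eigfam C K ?L" and onL: "orthonormal_in C ?L"
    using eigW L by (auto simp: eigfam_def orthonormal_in_def low_modes_def)
  have suppL: "supp_in C (lincomb ?L c)" for c
    by (rule supp_in_lincomb) (use onL in \<open>simp add: orthonormal_in_def\<close>)
  have "card ?L \<le> card (low_modes E A K U)"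
  proof (rule card_le_low_modes[OF A U orthonormal_in_mono[OF A CA onL]])
    fix c
    show "bform A K (lincomb ?L c) (lincomb ?L c) \<le> E * ip A (lincomb ?L c) (lincomb ?L c)"
      unfolding bform_mono_supp[OF A CA suppL suppL] ip_mono_supp[OF A CA suppL]
      by (rule form_le_on_low_modes[OF C(1) eigL]) (simp add: low_modes_def)
  qed
  then show "Nev E C K \<le> Nev E A K"
    by (simp add: Nev_eq_low_modes[OF A U] Nev_eq_low_modes[OF C(1) W])
  let ?F = "?L \<union> (\<lambda>z x. if x = z then 1 else 0) ` (A - C)"
  have "card (low_modes E A K U) \<le> card ?F"
  proof (rule low_modes_le_card[OF A U])
    show "finite ?F" using L A by simp
    fix f assume f: "supp_in A f" "\<exists>x\<in>A. f x \<noteq> 0" "\<forall>g\<in>?F. ip A f g = 0"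
    have "f x = 0" if x: "x \<in> A - C" for x
    proof -
      have "ip A f (\<lambda>y. if y = x then 1 else 0) = 0" using f(3) x by blast
      then show ?thesis using x A by (simp add: ip_def if_distrib cong: if_cong)
    qed
    then have sC: "supp_in C f" using f(1) by (auto simp: supp_in_def)
    have "bform C K f f > E * ip C f f"
    proof (rule form_gt_off_low_modes[OF C(1) W])
      show "\<forall>u\<in>?L. ip C f u = 0" using f(3) ip_mono_supp[OF A CA sC] by auto
      show "\<exists>x\<in>C. f x \<noteq> 0" using f(2) sC by (auto simp: supp_in_def)
    qed
    then show "bform A K f f > E * ip A f f"
      by (simp add: bform_mono_supp[OF A CA sC sC] ip_mono_supp[OF A CA sC])
  qed
  also have "\<dots> \<le> card ?L + card (A - C)"
    by (rule order_trans[OF card_Un_le]) (use A in \<open>simp add: card_image_le\<close>)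
  finally show "Nev E A K \<le> Nev E C K + card (A - C)"
    by (simp add: Nev_eq_low_modes[OF A U] Nev_eq_low_modes[OF C(1) W])
qed

text \<open>Both counts lie between the count on \<open>C\<close> and that count plus
  \<open>n\<close>, so they differ by at most \<open>n\<close> rather than \<open>2 * n\<close>. The
  kernels may disagree arbitrarily off \<open>C\<close>; this absorbs changes of boundary
  condition.\<close>

lemma Nev_close_of_common_part:
  assumes "finite A" "finite B" "sym_on A K" "sym_on B K'" "C \<subseteq> A" "C \<subseteq> B"
    and "\<And>x y. x \<in> C \<Longrightarrow> y \<in> C \<Longrightarrow> K x y = K' x y"
    and "card (A - C) \<le> n" "card (B - C) \<le> n"
  shows "\<bar>real (Nev E A K) - real (Nev E B K')\<bar> \<le> real n"
proof -
  have "Nev E C K = Nev E C K'"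
    using assms by (intro Nev_cong) (auto intro: finite_subset)
  then show ?thesis
    using interlacing[OF assms(1,5,3), of E] interlacing[OF assms(2,6,4), of E] assms(8,9) by linarith
qed

text \<open>The kernel is block diagonal: the union of eigenbases of the two parts, extended by
  zero, is an eigenbasis of the whole with the same Rayleigh quotients.\<close>

lemma Nev_Un_uncoupled:
  assumes A: "finite A" "finite B" "A \<inter> B = {}" and K: "sym_on (A \<union> B) K"
    and uncoupled: "\<And>x y. x \<in> A \<Longrightarrow> y \<in> B \<Longrightarrow> K x y = 0"
  shows "Nev E (A \<union> B) K = Nev E A K + Nev E B K"
proof -
  have unc': "K y x = 0" if "x \<in> A" "y \<in> B" for x y
    using uncoupled[OF that] K that by (simp add: sym_on_def)
  have symAB: "sym_on A K" "sym_on B K" using K by (auto simp: sym_on_def)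
  obtain U where U: "eigbasis A K U" using exists_eigbasis A symAB by blast
  obtain W where W: "eigbasis B K W" using exists_eigbasis A symAB by blast
  have onU: "orthonormal_in A U" and eU: "\<And>u x. u \<in> U \<Longrightarrow> x \<in> A \<Longrightarrow> (\<Sum>y\<in>A. K x y * u y) = bform A K u u * u x"
    and onW: "orthonormal_in B W" and eW: "\<And>u x. u \<in> W \<Longrightarrow> x \<in> B \<Longrightarrow> (\<Sum>y\<in>B. K x y * u y) = bform B K u u * u x"
    and card: "card U = card A" "card W = card B"
    using U W by (auto simp: eigbasis_def eigfam_def)
  let ?C = "A \<union> B"
  have C: "finite ?C" using A by simp
  have sU: "supp_in A u" if "u \<in> U" for u using onU that by (simp add: orthonormal_in_def)
  have sW: "supp_in B w" if "w \<in> W" for w using onW that by (simp add: orthonormal_in_def)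
  have orth: "ip ?C u w = 0" "ip ?C w u = 0" if "u \<in> U" "w \<in> W" for u w
    using sU[OF that(1)] sW[OF that(2)] A(3)
    by (auto simp: ip_def supp_in_def intro!: sum.neutral)
  have unit: "ip ?C u u = 1" if "u \<in> U" for u
    using ip_mono_supp[OF C _ sU[OF that], of u] onU that by (simp add: orthonormal_in_def)
  have UW: "U \<inter> W = {}" using orth unit by fastforce
  have on: "orthonormal_in ?C (U \<union> W)"
    unfolding orthonormal_in_def
  proof (intro conjI ballI)
    show "finite (U \<union> W)" using onU onW by (simp add: orthonormal_in_def)
    show "supp_in ?C u" if "u \<in> U \<union> W" for u using that sU sW by (auto simp: supp_in_def)
    show "ip ?C u w = (if u = w then 1 else 0)" if uw: "u \<in> U \<union> W" "w \<in> U \<union> W" for u w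
    proof -
      consider "u \<in> U" "w \<in> U" | "u \<in> W" "w \<in> W" | "u \<in> U" "w \<in> W" | "u \<in> W" "w \<in> U"
        using uw by blast
      then show ?thesis
      proof cases
        case 1 then show ?thesis
          using ip_mono_supp[OF C _ sU[OF 1(1)], of w] onU by (simp add: orthonormal_in_def)
      next
        case 2 then show ?thesis
          using ip_mono_supp[OF C _ sW[OF 2(1)], of w] onW by (simp add: orthonormal_in_def)
      next
        case 3 then show ?thesis using orth UW by auto
      next
        case 4 then show ?thesis using orth UW by auto
      qed
    qed
  qed
  have bU: "bform ?C K u u = bform A K u u" if "u \<in> U" for u
    using bform_mono_supp[OF C _ sU[OF that] sU[OF that]] by simp
  have bW: "bform ?C K w w = bform B K w w" if "w \<in> W" for w
    using bform_mono_supp[OF C _ sW[OF that] sW[OF that]] by simp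
  have "eigfam ?C K (U \<union> W)"
    unfolding eigfam_def
  proof (intro conjI ballI on)
    fix u x assume u: "u \<in> U \<union> W" and x: "x \<in> ?C"
    have split: "(\<Sum>y\<in>?C. K x y * u y) = (\<Sum>y\<in>A. K x y * u y) + (\<Sum>y\<in>B. K x y * u y)"
      using A by (intro sum.union_disjoint)
    show "(\<Sum>y\<in>?C. K x y * u y) = bform ?C K u u * u x"
    proof (cases "u \<in> U")
      case True
      have "u y = 0" if "y \<in> B" for y using sU[OF True] that A(3) by (auto simp: supp_in_def)
      then have "(\<Sum>y\<in>?C. K x y * u y) = (\<Sum>y\<in>A. K x y * u y)" unfolding split by simp
      moreover have "(\<Sum>y\<in>A. K x y * u y) = bform A K u u * u x"
      proof (cases "x \<in> A")
        case False
        then have "x \<in> B" using x by simp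
        then show ?thesis using unc' \<open>\<And>y. y \<in> B \<Longrightarrow> u y = 0\<close> by simp
      qed (use eU True in auto)
      ultimately show ?thesis using bU[OF True] by simp
    next
      case False
      then have uW: "u \<in> W" using u by simp
      have z: "u y = 0" if "y \<in> A" for y using sW[OF uW] that A(3) by (auto simp: supp_in_def)
      then have "(\<Sum>y\<in>?C. K x y * u y) = (\<Sum>y\<in>B. K x y * u y)" unfolding split by simp
      moreover have "(\<Sum>y\<in>B. K x y * u y) = bform B K u u * u x"
      proof (cases "x \<in> B")
        case False
        then have "x \<in> A" using x by simp
        then show ?thesis using uncoupled z by simp
      qed (use eW uW in auto)
      ultimately show ?thesis using bW[OF uW] by simp
    qed
  qed
  moreover have finUW: "finite U" "finite W" using onU onW by (auto simp: orthonormal_in_def)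
  moreover have "card (U \<union> W) = card ?C" using card A finUW UW by (simp add: card_Un_disjoint)
  ultimately have "eigbasis ?C K (U \<union> W)" by (simp add: eigbasis_def)
  then have "Nev E ?C K = card (low_modes E ?C K (U \<union> W))" by (rule Nev_eq_low_modes[OF C])
  also have "low_modes E ?C K (U \<union> W) = low_modes E A K U \<union> low_modes E B K W"
    using bU bW by (auto simp: low_modes_def)
  also have "card \<dots> = card (low_modes E A K U) + card (low_modes E B K W)"
    using finUW UW by (intro card_Un_disjoint) (auto simp: low_modes_def)
  finally show ?thesis by (simp add: Nev_eq_low_modes[OF A(1) U] Nev_eq_low_modes[OF A(2) W])
qed

text \<open>Upper semicontinuity of the eigenvalue count in the potential is what makes it measurable.\<close>

lemma Nev_upper_semicontinuous:
  assumes A: "finite A" and K: "sym_on A K"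
  obtains d where "d > 0" "\<And>K'. sym_on A K' \<Longrightarrow>
    (\<And>x y. x \<in> A \<Longrightarrow> y \<in> A \<Longrightarrow> x \<noteq> y \<Longrightarrow> K' x y = K x y) \<Longrightarrow>
    (\<And>x. x \<in> A \<Longrightarrow> \<bar>K' x x - K x x\<bar> \<le> d) \<Longrightarrow> Nev E A K' \<le> Nev E A K"
proof -
  obtain U where U: "eigbasis A K U" using exists_eigbasis A K by blast
  have fin: "finite U" using U by (simp add: eigbasis_def eigfam_def orthonormal_in_def)
  \<comment> \<open>At most half the distance from \<open>E\<close> to the next eigenvalue, so
    raising \<open>E\<close> to \<open>E + d\<close> adds no low mode, while a diagonal change by
    \<open>d\<close> costs the form at most \<open>d\<close> times the squared norm. The inserted 1
    covers the case that no eigenvalue exceeds \<open>E\<close>.\<close>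
  define d where "d = Min (insert 1 ((\<lambda>u. bform A K u u - E) ` (U - low_modes E A K U))) / 2"
  have pos: "2 * d > 0" using fin by (auto simp: d_def low_modes_def)
  have gap: "bform A K u u \<ge> E + 2 * d" if "u \<in> U - low_modes E A K U" for u
  proof -
    have "2 * d \<le> bform A K u u - E" unfolding d_def using fin that by simp
    then show ?thesis by simp
  qed
  then have low: "low_modes (E + d) A K U = low_modes E A K U"
    using pos by (fastforce simp: low_modes_def)
  have "Nev E A K' \<le> Nev E A K"
    if K': "sym_on A K'" and off: "\<And>x y. x \<in> A \<Longrightarrow> y \<in> A \<Longrightarrow> x \<noteq> y \<Longrightarrow> K' x y = K x y"
      and dg: "\<And>x. x \<in> A \<Longrightarrow> \<bar>K' x x - K x x\<bar> \<le> d" for K'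
  proof -
    obtain W where W: "eigbasis A K' W" using exists_eigbasis A K' by blast
    have "card (low_modes E A K' W) \<le> card (low_modes (E + d) A K U)"
    proof (rule low_modes_le_card[OF A W])
      show "finite (low_modes (E + d) A K U)" using fin by (simp add: low_modes_def)
      fix f assume f: "\<exists>x\<in>A. f x \<noteq> 0" "\<forall>g\<in>low_modes (E + d) A K U. ip A f g = 0"
      have row: "f x * (\<Sum>y\<in>A. K' x y * f y) = f x * (\<Sum>y\<in>A. K x y * f y) + (K' x x - K x x) * (f x * f x)"
        if x: "x \<in> A" for x
      proof -
        have "(\<Sum>y\<in>A. K' x y * f y) = K' x x * f x + (\<Sum>y\<in>A-{x}. K' x y * f y)"
          using A x by (simp add: sum.remove)
        also have "(\<Sum>y\<in>A-{x}. K' x y * f y) = (\<Sum>y\<in>A-{x}. K x y * f y)"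
          using off x by (intro sum.cong) auto
        also have "\<dots> = (\<Sum>y\<in>A. K x y * f y) - K x x * f x"
          using A x by (simp add: sum.remove)
        finally have eq: "(\<Sum>y\<in>A. K' x y * f y) = (\<Sum>y\<in>A. K x y * f y) + (K' x x - K x x) * f x"
          by (simp add: left_diff_distrib)
        show ?thesis unfolding eq by (simp only: distrib_left mult.left_commute)
      qed
      have "(E + d) * ip A f f < bform A K f f" by (rule form_gt_off_low_modes[OF A U f(2,1)])
      moreover have "bform A K f f - d * ip A f f \<le> bform A K' f f"
      proof -
        have "bform A K f f - d * ip A f f = (\<Sum>x\<in>A. f x * (\<Sum>y\<in>A. K x y * f y) - d * (f x * f x))"
          by (simp add: bform_def ip_def sum_subtractf sum_distrib_left)
        also have "\<dots> \<le> bform A K' f f"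
          unfolding bform_def
        proof (rule sum_mono)
          fix x assume x: "x \<in> A"
          have "- d * (f x * f x) \<le> (K' x x - K x x) * (f x * f x)"
            using dg[OF x] by (intro mult_right_mono) auto
          then show "f x * (\<Sum>y\<in>A. K x y * f y) - d * (f x * f x) \<le> f x * (\<Sum>y\<in>A. K' x y * f y)"
            unfolding row[OF x] by simp
        qed
        finally show ?thesis .
      qed
      ultimately show "E * ip A f f < bform A K' f f" by (simp add: algebra_simps)
    qed
    then show ?thesis by (simp add: low Nev_eq_low_modes[OF A U] Nev_eq_low_modes[OF A W])
  qed
  then show thesis using that[of d] pos by simp
qed

subsection \<open>Geometry of the Sierpinski lattice\<close>

text \<open>Coordinates with respect to the basis \<open>a2\<close>, \<open>a3\<close>.\<close>

definition cu :: "pt \<Rightarrow> real" where "cu p = fst p - snd p / sqrt 3"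
definition cv :: "pt \<Rightarrow> real" where "cv p = 2 * snd p / sqrt 3"

lemma cu_cv_simps [simp]:
  "cu (p + q) = cu p + cu q" "cv (p + q) = cv p + cv q"
  "cu (c *\<^sub>R p) = c * cu p" "cv (c *\<^sub>R p) = c * cv p"
  "cu 0 = 0" "cv 0 = 0" "cu a1 = 0" "cv a1 = 0" "cu a2 = 1" "cv a2 = 0" "cu a3 = 0" "cv a3 = 1"
  "cu (mir p) = - cu p - cv p" "cv (mir p) = cv p"
  by (auto simp: cu_def cv_def a1_def a2_def a3_def mir_def field_simps)

lemma pt_eq_iff: "p = q \<longleftrightarrow> cu p = cu q \<and> cv p = cv q"
  by (auto simp: cu_def cv_def prod_eq_iff)

lemma a1_eq_0: "a1 = 0"
  by (simp add: a1_def zero_prod_def)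

lemma mem_T0_iff: "p \<in> T0 \<longleftrightarrow> cu p \<ge> 0 \<and> cv p \<ge> 0 \<and> cu p + cv p \<le> 1"
proof
  assume "p \<in> T0"
  then obtain r s t where "0 \<le> r" "0 \<le> s" "0 \<le> t" "r + s + t = 1"
    "p = r *\<^sub>R a1 + s *\<^sub>R a2 + t *\<^sub>R a3"
    by (auto simp: T0_def convex_hull_3)
  then show "cu p \<ge> 0 \<and> cv p \<ge> 0 \<and> cu p + cv p \<le> 1" by simp
next
  assume p: "cu p \<ge> 0 \<and> cv p \<ge> 0 \<and> cu p + cv p \<le> 1"
  have "p = (1 - cu p - cv p) *\<^sub>R a1 + cu p *\<^sub>R a2 + cv p *\<^sub>R a3"
    by (simp add: pt_eq_iff)
  moreover have "0 \<le> 1 - cu p - cv p" "1 - cu p - cv p + cu p + cv p = 1" using p by auto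
  ultimately show "p \<in> T0" unfolding T0_def convex_hull_3 using p by blast
qed

section \<open>Unit cells and their vertices\<close>

text \<open>These points play two roles: they are the extreme vertices of \<open>Gn n\<close>, and
  they are the translations carrying level \<open>n\<close> onto the three blocks of level
  \<open>n + 1\<close>. Corner \<open>c\<close> of block \<open>t\<close> is therefore
  \<open>c + t\<close>.\<close>

definition corners :: "nat \<Rightarrow> pt set" where
  "corners n = {0, 2 ^ n *\<^sub>R a2, 2 ^ n *\<^sub>R a3}"

text \<open>The lower left vertices of the upward unit triangles that make up \<open>Tn n\<close>;
  the recursion replaces containment of convex sets by integer coordinates.\<close>

fun cells :: "nat \<Rightarrow> pt set" where
  "cells 0 = {0}"
| "cells (Suc n) = (\<Union>t\<in>corners n. (\<lambda>p. p + t) ` cells n)"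

lemma finite_corners [simp]: "finite (corners n)"
  by (simp add: corners_def)

lemma card_corners: "card (corners n) = 3"
  by (simp add: corners_def pt_eq_iff)

lemma corners_Suc: "corners (Suc n) = (\<lambda>t. t + t) ` corners n"
  by (simp add: corners_def scaleR_add_left[symmetric])

lemma zero_in_corners: "0 \<in> corners n"
  by (simp add: corners_def)

lemma finite_cells [simp]: "finite (cells n)"
  by (induction n) auto

lemma cells_props:
  "s \<in> cells n \<Longrightarrow> cu s \<ge> 0 \<and> cv s \<ge> 0 \<and> cu s + cv s \<le> 2 ^ n - 1 \<and> cu s \<in> \<int> \<and> cv s \<in> \<int>"
proof (induction n arbitrary: s)
  case (Suc n)
  then obtain s' t where s': "s' \<in> cells n" "t \<in> corners n" "s = s' + t" by auto
  have "(2::real) ^ n \<in> \<int>" by simp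
  then show ?case using Suc.IH[OF s'(1)] s'(2,3) by (auto simp: corners_def)
qed simp

lemma Tn_eq: "Tn n = (\<Union>s\<in>cells n. (\<lambda>p. s + p) ` T0)"
proof (induction n)
  case (Suc n)
  have "Tn (Suc n) = (\<Union>t\<in>corners n. (\<lambda>p. p + t) ` Tn n)"
    by (simp add: corners_def Un_assoc)
  also have "\<dots> = (\<Union>t\<in>corners n. \<Union>s\<in>(\<lambda>p. p + t) ` cells n. (\<lambda>p. s + p) ` T0)"
    by (simp add: Suc image_UN image_image add_ac)
  finally show ?case unfolding cells.simps UN_UN_flatten .
qed simp

text \<open>If \<open>t\<close> has coordinates \<open>(i + a, j + b)\<close> with fractional parts \<open>a\<close>, \<open>b\<close> not both zero, then
  \<open>t + T0\<close> contains the point \<open>(i + (1 + a) / 2, j + (1 + b) / 2)\<close>, which lies inside a downward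
  pointing unit triangle and hence outside \<open>Tn n\<close>.\<close>

lemma unit_tris_eq: "unit_tris n = cells n"
proof
  show "cells n \<subseteq> unit_tris n" by (auto simp: unit_tris_def Tn_eq)
  show "unit_tris n \<subseteq> cells n"
  proof
    fix t assume t: "t \<in> unit_tris n"
    define i j where "i = real_of_int \<lfloor>cu t\<rfloor>" and "j = real_of_int \<lfloor>cv t\<rfloor>"
    have ij: "i \<le> cu t" "cu t < i + 1" "j \<le> cv t" "cv t < j + 1"
      unfolding i_def j_def by linarith+
    define p where "p = ((1 - (cu t - i)) / 2) *\<^sub>R a2 + ((1 - (cv t - j)) / 2) *\<^sub>R a3"
    have "p \<in> T0" using ij by (simp add: mem_T0_iff p_def field_simps)
    then have "t + p \<in> Tn n" using t by (auto simp: unit_tris_def)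
    then obtain s q where s: "s \<in> cells n" "q \<in> T0" "t + p = s + q" by (auto simp: Tn_eq)
    obtain a b :: int where ab: "cu s = of_int a" "cv s = of_int b"
      using cells_props[OF s(1)] by (auto elim!: Ints_cases)
    have eq: "cu t + (1 - (cu t - i)) / 2 = of_int a + cu q"
      "cv t + (1 - (cv t - j)) / 2 = of_int b + cv q"
      using s(3) ab by (auto simp: pt_eq_iff p_def)
    have q: "cu q \<ge> 0" "cv q \<ge> 0" "cu q + cv q \<le> 1" using s(2) by (auto simp: mem_T0_iff)
    have "of_int a < i + 1" "of_int b < j + 1" using eq q ij by (simp_all add: field_simps)
    then have le: "a \<le> \<lfloor>cu t\<rfloor>" "b \<le> \<lfloor>cv t\<rfloor>" unfolding i_def j_def by linarith+
    have "i + j < of_int a + of_int b + 1" using eq q ij by (simp add: field_simps)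
    then have "\<lfloor>cu t\<rfloor> + \<lfloor>cv t\<rfloor> < a + b + 1" unfolding i_def j_def by linarith
    then have ab': "of_int a = i" "of_int b = j" using le by (auto simp: i_def j_def)
    \<comment> \<open>Now \<open>q\<close> has coordinates \<open>(1 + cu t - i) / 2\<close> and
      \<open>(1 + cv t - j) / 2\<close>. Their sum is at most 1, so both fractional parts
      vanish.\<close>
    then have "cu t = i" "cv t = j" using eq q ij by (auto simp: field_simps)
    then have "t = s" using ab ab' by (simp add: pt_eq_iff)
    then show "t \<in> cells n" using s by simp
  qed
qed

lemma mem_tri_vertices: "x \<in> tri_vertices s \<longleftrightarrow> x = s \<or> x = s + a2 \<or> x = s + a3"
  by (simp add: tri_vertices_def a1_eq_0)

lemma finite_tri_vertices [simp]: "finite (tri_vertices s)"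
  by (simp add: tri_vertices_def)

lemma tri_vertices_add: "x + t \<in> tri_vertices (s + t) \<longleftrightarrow> x \<in> tri_vertices s"
  by (auto simp: mem_tri_vertices pt_eq_iff)

lemma tri_vertices_coords:
  assumes "x \<in> tri_vertices s"
  shows "cu s \<le> cu x" "cv s \<le> cv x" "cu x + cv x \<le> cu s + cv s + 1"
    "cu x + cv x = cu s + cv s \<Longrightarrow> x = s"
  using assms by (auto simp: mem_tri_vertices)

lemma mir_mir [simp]: "mir (mir p) = p"
  by (simp add: mir_def)

lemma inj_mir: "inj_on mir A"
  by (metis inj_onI mir_mir)

lemma Gn_eq: "Gn n = (\<Union>s\<in>cells n. tri_vertices s)"
  by (simp add: Gn_def unit_tris_eq)

lemma finite_Gn [simp]: "finite (Gn n)"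
  by (simp add: Gn_eq)

lemma Gn_Suc: "Gn (Suc n) = (\<Union>t\<in>corners n. (\<lambda>p. p + t) ` Gn n)"
proof -
  have "tri_vertices (s + t) = (\<lambda>p. p + t) ` tri_vertices s" for s t
    by (simp add: tri_vertices_def add_ac)
  then have "(\<Union>s\<in>(\<lambda>p. p + t) ` cells n. tri_vertices s) = (\<lambda>p. p + t) ` Gn n" for t
    by (simp add: Gn_eq image_UN)
  then show ?thesis unfolding Gn_eq[of "Suc n"] cells.simps UN_UN_flatten by simp
qed

lemma Gn_coords:
  assumes "x \<in> Gn n"
  shows "cu x \<ge> 0" "cv x \<ge> 0" "cu x + cv x \<le> 2 ^ n"
proof -
  obtain s where "s \<in> cells n" "x \<in> tri_vertices s" using assms by (auto simp: Gn_eq)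
  with cells_props[OF this(1)] tri_vertices_coords[OF this(2)]
  show "cu x \<ge> 0" "cv x \<ge> 0" "cu x + cv x \<le> 2 ^ n" by auto
qed

lemma Gtilde_eq: "Gtilde n = Gn n - corners n"
  by (simp add: Gtilde_def corners_def a1_eq_0)

lemma Gtilde_subset: "Gtilde n \<subseteq> Gn n"
  by (auto simp: Gtilde_eq)

lemma finite_Gtilde [simp]: "finite (Gtilde n)"
  by (simp add: Gtilde_eq)

lemma Gn_subset_SG: "Gn n \<subseteq> SG"
  by (auto simp: SG_def)

lemma mir_SG: "x \<in> SG \<Longrightarrow> mir x \<in> SG"
  by (auto simp: SG_def Gn'_def)

lemma corners_subset_Gn: "corners n \<subseteq> Gn n"
proof (induction n)
  case 0
  then show ?case by (auto simp: corners_def Gn_eq mem_tri_vertices)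
next
  case (Suc n)
  show ?case
  proof
    fix c assume "c \<in> corners (Suc n)"
    then obtain t where "t \<in> corners n" "c = t + t" unfolding corners_Suc by blast
    then show "c \<in> Gn (Suc n)" using Suc unfolding Gn_Suc by blast
  qed
qed

lemma adj_iff:
  "adj x y \<longleftrightarrow> x \<noteq> y \<and> (\<exists>n. \<exists>s\<in>cells n. (x \<in> tri_vertices s \<and> y \<in> tri_vertices s)
      \<or> (mir x \<in> tri_vertices s \<and> mir y \<in> tri_vertices s))"
proof -
  have "x \<in> mir ` T \<longleftrightarrow> mir x \<in> T" for x T by (metis image_iff mir_mir)
  then show ?thesis by (simp add: adj_def unit_tris_eq)
qed

lemma adj_sym: "adj x y \<longleftrightarrow> adj y x"
  unfolding adj_iff by blast

lemma adj_mir: "adj (mir x) (mir y) \<longleftrightarrow> adj x y"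
proof -
  have "mir x = mir y \<longleftrightarrow> x = y" by (metis mir_mir)
  then show ?thesis unfolding adj_iff mir_mir by blast
qed

section \<open>Locality of adjacency\<close>

lemma cells_mono: "n \<le> m \<Longrightarrow> cells n \<subseteq> cells m"
  by (rule lift_Suc_mono_le[of cells]) (auto simp: corners_def)

text \<open>A cell that first appears above level \<open>n\<close> is a translate by a far corner of
  some level at least \<open>n\<close>, so it starts on or beyond the far side of the level
  \<open>n\<close> triangle, and on that side only at an end point. Since \<open>adj\<close>
  quantifies over all levels, this is what confines it to level \<open>n\<close>.\<close>

lemma cells_local:
  assumes "s \<in> cells m" "s \<notin> cells n"
  shows "cu s + cv s \<ge> 2 ^ n \<and> (cu s + cv s = 2 ^ n \<longrightarrow> s \<in> corners n)"
  using assms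
proof (induction m)
  case 0
  then show ?case using cells_mono[of 0 n] by auto
next
  case (Suc m)
  show ?case
  proof (cases "s \<in> cells m")
    case False
    have "n \<le> m" using Suc.prems cells_mono[of "Suc m" n] by (meson not_less_eq_eq subsetD)
    then have pow: "(2::real) ^ n \<le> 2 ^ m" by simp
    obtain s' t where s': "s' \<in> cells m" "t \<in> corners m" "s = s' + t" using Suc.prems by auto
    have nn: "cu s' \<ge> 0" "cv s' \<ge> 0" using cells_props[OF s'(1)] by auto
    have "t \<noteq> 0" using False s' by auto
    then consider "t = 2 ^ m *\<^sub>R a2" | "t = 2 ^ m *\<^sub>R a3" using s'(2) by (auto simp: corners_def)
    then show ?thesis
    proof cases
      case 1
      then have c: "cu s = cu s' + 2 ^ m" "cv s = cv s'" using s'(3) by auto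
      have "s = 2 ^ n *\<^sub>R a2" if "cu s + cv s = 2 ^ n"
      proof -
        have "cu s = 2 ^ n" "cv s = 0" using that c nn pow by linarith+
        then show ?thesis by (simp add: pt_eq_iff)
      qed
      then show ?thesis using c nn pow by (auto simp: corners_def simp del: power_increasing_iff)
    next
      case 2
      then have c: "cu s = cu s'" "cv s = cv s' + 2 ^ m" using s'(3) by auto
      have "s = 2 ^ n *\<^sub>R a3" if "cu s + cv s = 2 ^ n"
      proof -
        have "cv s = 2 ^ n" "cu s = 0" using that c nn pow by linarith+
        then show ?thesis by (simp add: pt_eq_iff)
      qed
      then show ?thesis using c nn pow by (auto simp: corners_def simp del: power_increasing_iff)
    qed
  qed (use Suc in auto)
qed

lemma mir_vertex_in_Gn:
  assumes "x \<in> Gn n" "mir x \<in> tri_vertices s" "s \<in> cells m"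
  shows "x = 0"
proof -
  have "cu (mir x) \<ge> 0" "cv (mir x) \<ge> 0"
    using tri_vertices_coords[OF assms(2)] cells_props[OF assms(3)] by linarith+
  then show ?thesis using Gn_coords[OF assms(1)] by (simp add: pt_eq_iff)
qed

lemma vertex_of_foreign_cell:
  assumes "x \<in> Gn n" "x \<in> tri_vertices s" "s \<in> cells m" "s \<notin> cells n"
  shows "x = s \<and> x \<in> corners n"
proof -
  have "cu s + cv s \<ge> 2 ^ n" "cu s + cv s = 2 ^ n \<longrightarrow> s \<in> corners n"
    using cells_local[OF assms(3,4)] by auto
  moreover have "cu x + cv x = cu s + cv s" "cu s + cv s \<le> 2 ^ n"
    using Gn_coords(3)[OF assms(1)] tri_vertices_coords[OF assms(2)] calculation by linarith+
  ultimately show ?thesis using tri_vertices_coords(4)[OF assms(2)] by auto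
qed

text \<open>Cells of later levels and mirrored cells can meet \<open>Gn n\<close> only in a corner,
  so every cell through a non-corner point belongs to level \<open>n\<close>.\<close>

lemma Gtilde_neighbour:
  assumes x: "x \<in> Gtilde n" and adj: "adj x y"
  obtains s where "s \<in> cells n" "x \<in> tri_vertices s" "y \<in> tri_vertices s"
proof -
  obtain m s where s: "s \<in> cells m" "(x \<in> tri_vertices s \<and> y \<in> tri_vertices s)
      \<or> (mir x \<in> tri_vertices s \<and> mir y \<in> tri_vertices s)"
    using adj unfolding adj_iff by blast
  have x': "x \<in> Gn n" "x \<notin> corners n" using x by (auto simp: Gtilde_eq)
  then show thesis
    using that s mir_vertex_in_Gn[OF x'(1)] vertex_of_foreign_cell[OF x'(1)] zero_in_corners by blast
qed

lemma Gtilde_neighbour_in_Gn: "x \<in> Gtilde n \<Longrightarrow> adj x y \<Longrightarrow> y \<in> Gn n"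
  by (erule Gtilde_neighbour) (auto simp: Gn_eq)

lemma adj_within_Gn:
  assumes "x \<in> Gn n" "y \<in> Gn n" "adj x y"
  obtains s where "s \<in> cells n" "x \<in> tri_vertices s" "y \<in> tri_vertices s"
proof -
  obtain m s where s: "s \<in> cells m" "(x \<in> tri_vertices s \<and> y \<in> tri_vertices s)
      \<or> (mir x \<in> tri_vertices s \<and> mir y \<in> tri_vertices s)" and "x \<noteq> y"
    using assms(3) unfolding adj_iff by blast
  then show thesis
    using that mir_vertex_in_Gn[OF assms(1)] mir_vertex_in_Gn[OF assms(2)]
      vertex_of_foreign_cell[OF assms(1)] vertex_of_foreign_cell[OF assms(2)] by metis
qed

section \<open>Blocks of the next level\<close>

text \<open>The triangles \<open>Gn n + t\<close> and \<open>Gn n + t'\<close> touch only in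
  \<open>t + t'\<close>, the midpoint of the outer corners \<open>t + t\<close> and
  \<open>t' + t'\<close>.\<close>

lemma blocks_meet:
  assumes "x \<in> Gn n" "y \<in> Gn n" "t \<in> corners n" "t' \<in> corners n" "t \<noteq> t'" "x + t = y + t'"
  shows "x = t'"
  using Gn_coords[OF assms(1)] Gn_coords[OF assms(2)] assms(3-6)
  by (auto simp: corners_def pt_eq_iff)

lemma shift_mem_Gn: "x \<in> Gn n \<Longrightarrow> t \<in> corners n \<Longrightarrow> x + t \<in> Gn (Suc n)"
  by (auto simp: Gn_Suc)

lemma shift_mem_Gtilde:
  assumes x: "x \<in> Gtilde n" and t: "t \<in> corners n"
  shows "x + t \<in> Gtilde (Suc n)"
proof -
  have x': "x \<in> Gn n" "x \<notin> corners n" using x by (auto simp: Gtilde_eq)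
  have "x + t \<noteq> c + c" if c: "c \<in> corners n" for c
  proof
    assume eq: "x + t = c + c"
    show False
    proof (cases "t = c")
      case True then show False using eq x' c by simp
    next
      case False
      then show False
        using blocks_meet[OF x'(1) _ t c _ eq] corners_subset_Gn[of n] c x'(2) by auto
    qed
  qed
  then have "x + t \<notin> corners (Suc n)" unfolding corners_Suc by blast
  then show ?thesis using shift_mem_Gn[OF x'(1) t] by (simp add: Gtilde_eq)
qed

lemma vertex_of_shifted_cell:
  assumes "x \<in> Gn n" "t \<in> corners n" "s \<in> cells n" "t' \<in> corners n" "x + t \<in> tri_vertices (s + t')"
    and "t \<noteq> t'"
  shows "x = t'"
proof -
  define y where "y = x + t - t'"
  have eq: "x + t = y + t'" by (simp add: y_def)
  have "y \<in> tri_vertices s" using assms(5) unfolding eq tri_vertices_add .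
  then have "y \<in> Gn n" using assms(3) by (auto simp: Gn_eq)
  then show ?thesis using blocks_meet[OF assms(1) _ assms(2,4,6) eq] by simp
qed

lemma adj_shift:
  assumes x: "x \<in> Gn n" and y: "y \<in> Gn n" and t: "t \<in> corners n"
  shows "adj (x + t) (y + t) \<longleftrightarrow> adj x y"
proof
  assume "adj x y"
  then obtain s where s: "s \<in> cells n" "x \<in> tri_vertices s" "y \<in> tri_vertices s" and ne: "x \<noteq> y"
    using adj_within_Gn[OF x y] by (auto simp: adj_iff)
  then have "s + t \<in> cells (Suc n)" using t by auto
  then show "adj (x + t) (y + t)"
    unfolding adj_iff using s ne tri_vertices_add by (metis add_right_cancel)
next
  assume a: "adj (x + t) (y + t)"
  then have ne: "x \<noteq> y" by (auto simp: adj_iff)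
  obtain s where s: "s \<in> cells (Suc n)" "x + t \<in> tri_vertices s" "y + t \<in> tri_vertices s"
    using adj_within_Gn[OF shift_mem_Gn[OF x t] shift_mem_Gn[OF y t] a] .
  then obtain s' t' where s': "s' \<in> cells n" "t' \<in> corners n" "s = s' + t'" by auto
  \<comment> \<open>In any other block both \<open>x\<close> and \<open>y\<close> would be the
    junction point \<open>t'\<close>, contradicting \<open>x \<noteq> y\<close>.\<close>
  have "t' = t"
    using vertex_of_shifted_cell[OF x t s'(1,2)] vertex_of_shifted_cell[OF y t s'(1,2)] s s' ne by metis
  then show "adj x y" unfolding adj_iff using s s' ne by (auto simp: tri_vertices_add)
qed

lemma adj_across_blocks:
  assumes x: "x \<in> Gtilde n" and y: "y \<in> Gn n" "y \<notin> corners n" and t: "t \<in> corners n" "t' \<in> corners n" "t \<noteq> t'"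
  shows "\<not> adj (x + t) (y + t')"
proof
  assume "adj (x + t) (y + t')"
  then obtain s where s: "s \<in> cells (Suc n)" "x + t \<in> tri_vertices s" "y + t' \<in> tri_vertices s"
    using Gtilde_neighbour[OF shift_mem_Gtilde[OF x t(1)]] by blast
  then obtain s' c where s': "s' \<in> cells n" "c \<in> corners n" "s = s' + c" by auto
  have x': "x \<in> Gn n" "x \<notin> corners n" using x by (auto simp: Gtilde_eq)
  have "t = c" using vertex_of_shifted_cell[OF x'(1) t(1) s'(1,2)] s s' x'(2) by metis
  moreover have "t' = c" using vertex_of_shifted_cell[OF y(1) t(2) s'(1,2)] s s' y(2) by metis
  ultimately show False using t(3) by simp
qed

lemma blocks_disjoint:
  assumes "t \<in> corners n" "t' \<in> corners n" "t \<noteq> t'"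
  shows "(\<lambda>p. p + t) ` Gtilde n \<inter> (\<lambda>p. p + t') ` Gtilde n = {}"
proof (rule ccontr)
  assume "\<not> ?thesis"
  then obtain x y where "x \<in> Gtilde n" "y \<in> Gtilde n" "x + t = y + t'" by blast
  then show False using blocks_meet[OF _ _ assms, of x y] assms(2) by (simp add: Gtilde_eq)
qed

lemma deg_in_eq_deg:
  assumes "x \<in> Gtilde n" "Gn n \<subseteq> A" "A \<subseteq> SG"
  shows "deg_in A x = deg x"
  unfolding deg_in_def deg_def
  using assms Gtilde_neighbour_in_Gn[OF assms(1)] by (intro arg_cong[of _ _ card]) auto

text \<open>All neighbours of a non-corner point stay inside its block, so they are translated along
  with it. This makes the simple diagonal invariant under the block translations.\<close>

lemma deg_shift:
  assumes x: "x \<in> Gtilde n" and t: "t \<in> corners n"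
  shows "deg (x + t) = deg x"
proof -
  have xG: "x \<in> Gn n" using x Gtilde_subset by auto
  have "deg_in (Gn (Suc n)) (x + t) = card {y \<in> Gn (Suc n). adj (x + t) y}" by (simp add: deg_in_def)
  also have "{y \<in> Gn (Suc n). adj (x + t) y} = (\<lambda>p. p + t) ` {y \<in> Gn n. adj x y}"
  proof (intro equalityI subsetI)
    fix z assume "z \<in> {y \<in> Gn (Suc n). adj (x + t) y}"
    then have z: "adj (x + t) z" by simp
    obtain s where s: "s \<in> cells (Suc n)" "x + t \<in> tri_vertices s" "z \<in> tri_vertices s"
      using Gtilde_neighbour[OF shift_mem_Gtilde[OF x t] z] .
    then obtain s' c where s': "s' \<in> cells n" "c \<in> corners n" "s = s' + c" by auto
    have "c = t" using vertex_of_shifted_cell[OF xG t s'(1,2)] s s' x by (auto simp: Gtilde_eq)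
    then have "z - t \<in> Gn n" using s(3) s' tri_vertices_add[of "z - t" t s'] by (auto simp: Gn_eq)
    moreover from this have "adj x (z - t)" using adj_shift[OF xG _ t, of "z - t"] z by simp
    ultimately show "z \<in> (\<lambda>p. p + t) ` {y \<in> Gn n. adj x y}"
      by (intro image_eqI[of _ _ "z - t"]) auto
  next
    fix z assume "z \<in> (\<lambda>p. p + t) ` {y \<in> Gn n. adj x y}"
    then show "z \<in> {y \<in> Gn (Suc n). adj (x + t) y}"
      using adj_shift[OF xG _ t] shift_mem_Gn[OF _ t] by auto
  qed
  also have "card \<dots> = deg_in (Gn n) x" by (simp add: card_image deg_in_def)
  finally show ?thesis
    using deg_in_eq_deg[OF shift_mem_Gtilde[OF x t] subset_refl Gn_subset_SG]
      deg_in_eq_deg[OF x subset_refl Gn_subset_SG] by simp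
qed

lemma deg_mir: "deg (mir x) = deg x"
proof -
  have "{y \<in> SG. adj (mir x) y} = mir ` {y \<in> SG. adj x y}"
  proof (intro equalityI subsetI)
    fix y assume "y \<in> {y \<in> SG. adj (mir x) y}"
    then show "y \<in> mir ` {y \<in> SG. adj x y}"
      using adj_mir[of x "mir y"] mir_SG by (intro image_eqI[of _ _ "mir y"]) auto
  next
    fix z assume "z \<in> mir ` {y \<in> SG. adj x y}"
    then obtain y where "y \<in> SG" "adj x y" "z = mir y" by blast
    then show "z \<in> {y \<in> SG. adj (mir x) y}" using adj_mir mir_SG by simp
  qed
  then show ?thesis by (simp add: deg_def card_image inj_mir)
qed

section \<open>Bounded degree and the inner core\<close>

lemma tri_vertices_diff:
  assumes "x \<in> tri_vertices s" "y \<in> tri_vertices s" "x \<noteq> y"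
  shows "(cu y - cu x, cv y - cv x) \<in> {(1, 0), (-1, 0), (0, 1), (0, -1), (-1, 1), (1, -1)}"
proof -
  have "x = s \<or> x = s + a2 \<or> x = s + a3" "y = s \<or> y = s + a2 \<or> y = s + a3"
    using assms by (simp_all add: mem_tri_vertices)
  then show ?thesis using assms(3) by (elim disjE) simp_all
qed

lemma adj_diff:
  assumes "adj x y"
  shows "y \<in> (\<lambda>(a, b). x + (a *\<^sub>R a2 + b *\<^sub>R a3)) ` {(1, 0), (-1, 0), (0, 1), (0, -1), (-1, 1), (1, -1)}"
    (is "_ \<in> _ ` ?D")
proof -
  obtain s where ne: "x \<noteq> y" and s: "x \<in> tri_vertices s \<and> y \<in> tri_vertices s
      \<or> mir x \<in> tri_vertices s \<and> mir y \<in> tri_vertices s"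
    using assms unfolding adj_iff by blast
  from s have d: "(cu y - cu x, cv y - cv x) \<in> ?D"
  proof
    assume "x \<in> tri_vertices s \<and> y \<in> tri_vertices s"
    then show ?thesis using tri_vertices_diff ne by metis
  next
    assume m: "mir x \<in> tri_vertices s \<and> mir y \<in> tri_vertices s"
    define a b where "a = cu (mir y) - cu (mir x)" and "b = cv (mir y) - cv (mir x)"
    have "mir x \<noteq> mir y" using ne by (metis mir_mir)
    then have "(a, b) \<in> ?D" unfolding a_def b_def using tri_vertices_diff[of "mir x" s "mir y"] m by metis
    \<comment> \<open>Reflection acts on coordinate differences by (a, b) -> (-a - b, b), which
      permutes the six lattice directions.\<close>
    then have "(- a - b, b) \<in> ?D" by auto
    moreover have "cu y - cu x = - a - b" "cv y - cv x = b" by (simp_all add: a_def b_def)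
    ultimately show ?thesis by (simp only:)
  qed
  show ?thesis by (rule image_eqI[OF _ d]) (simp add: pt_eq_iff)
qed

lemma card_neighbours: "finite {y. adj x y}" "card {y. adj x y} \<le> 6"
proof -
  let ?D = "{(1, 0), (-1, 0), (0, 1), (0, -1), (-1, 1), (1, -1)} :: (real \<times> real) set"
  let ?f = "\<lambda>(a, b). x + (a *\<^sub>R a2 + b *\<^sub>R a3)"
  have sub: "{y. adj x y} \<subseteq> ?f ` ?D" by (rule subsetI, rule adj_diff) simp
  then show "finite {y. adj x y}" by (rule finite_subset) simp
  have "card {y. adj x y} \<le> card (?f ` ?D)" by (rule card_mono[OF _ sub]) simp
  also have "\<dots> \<le> card ?D" by (rule card_image_le) simp
  finally show "card {y. adj x y} \<le> 6" by simp
qed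

text \<open>Points of the truncated triangle next to a removed corner have lost a neighbour, so
  there the three boundary conditions differ. On the core they agree. At most 3 * 6 points are given
  up, by the crude bound of six neighbours per corner.\<close>

definition Gcore :: "nat \<Rightarrow> pt set" where
  "Gcore n = {x \<in> Gtilde n. \<forall>c\<in>corners n. \<not> adj c x}"

lemma card_Gtilde_minus_Gcore: "card (Gtilde n - Gcore n) \<le> 18"
proof -
  have "card (Gtilde n - Gcore n) \<le> card (\<Union>c\<in>corners n. {y. adj c y})"
    using card_neighbours by (intro card_mono) (auto simp: Gcore_def)
  also have "\<dots> \<le> (\<Sum>c\<in>corners n. card {y. adj c y})" by (rule card_UN_le) simp
  also have "\<dots> \<le> (\<Sum>c\<in>corners n. 6)" by (intro sum_mono card_neighbours)
  finally show ?thesis by (simp add: card_corners)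
qed

lemma deg_in_Gtilde_eq_deg:
  assumes "x \<in> Gcore n"
  shows "deg_in (Gtilde n) x = deg x"
proof -
  have x: "x \<in> Gtilde n" "\<And>c. c \<in> corners n \<Longrightarrow> \<not> adj x c"
    using assms adj_sym by (auto simp: Gcore_def)
  have "{y \<in> Gtilde n. adj x y} = {y \<in> SG. adj x y}"
    using x(2) Gtilde_neighbour_in_Gn[OF x(1)] Gn_subset_SG[of n] unfolding Gtilde_eq by blast
  then show ?thesis by (simp add: deg_in_def deg_def)
qed

section \<open>Decomposition into blocks and growth of cardinalities\<close>

definition blocks :: "nat \<Rightarrow> pt set" where
  "blocks n = (\<Union>t\<in>corners n. (\<lambda>p. p + t) ` Gtilde n)"

lemma blocks_subset: "blocks n \<subseteq> Gtilde (Suc n)"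
  using shift_mem_Gtilde by (auto simp: blocks_def)

text \<open>A point outside the blocks is a corner of some block, hence a sum of two corners, and
  there are nine pairs. The bound is crude: it also counts the outer corners and counts each
  junction twice.\<close>

lemma card_Gtilde_minus_blocks: "card (Gtilde (Suc n) - blocks n) \<le> 9"
proof -
  have "Gtilde (Suc n) - blocks n \<subseteq> (\<lambda>(s, t). s + t) ` (corners n \<times> corners n)"
  proof
    fix z assume z: "z \<in> Gtilde (Suc n) - blocks n"
    then obtain x t where "x \<in> Gn n" "t \<in> corners n" "z = x + t"
      by (auto simp: Gtilde_eq Gn_Suc)
    moreover from this have "x \<in> corners n" using z by (auto simp: blocks_def Gtilde_eq)
    ultimately show "z \<in> (\<lambda>(s, t). s + t) ` (corners n \<times> corners n)" by auto
  qed
  then have "card (Gtilde (Suc n) - blocks n) \<le> card ((\<lambda>(s, t). s + t) ` (corners n \<times> corners n))"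
    by (intro card_mono) auto
  also have "\<dots> \<le> card (corners n \<times> corners n)" by (rule card_image_le) simp
  finally show ?thesis by (simp add: card_cartesian_product card_corners)
qed

lemma card_blocks: "card (blocks n) = 3 * card (Gtilde n)"
proof -
  have "card (blocks n) = (\<Sum>t\<in>corners n. card ((\<lambda>p. p + t) ` Gtilde n))"
    unfolding blocks_def using blocks_disjoint by (intro card_UN_disjoint) auto
  then show ?thesis by (simp add: card_image card_corners)
qed

lemma card_Gtilde_Suc:
  "3 * card (Gtilde n) \<le> card (Gtilde (Suc n))"
  "card (Gtilde (Suc n)) \<le> 3 * card (Gtilde n) + 9"
proof -
  have "card (Gtilde (Suc n)) = card (blocks n) + card (Gtilde (Suc n) - blocks n)"
    using card_Un_disjoint[of "blocks n" "Gtilde (Suc n) - blocks n"] blocks_subset[of n]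
    by (simp add: finite_subset[OF blocks_subset] Un_absorb1)
  then show "3 * card (Gtilde n) \<le> card (Gtilde (Suc n))"
    "card (Gtilde (Suc n)) \<le> 3 * card (Gtilde n) + 9"
    using card_Gtilde_minus_blocks[of n] by (auto simp: card_blocks)
qed

text \<open>\<open>Gtilde 0\<close> is empty, hence the index shift. The bound keeps the limit of
  \<open>card (Gtilde n) / 3 ^ n\<close> at least 1/3, so it can serve as a denominator.\<close>

lemma card_Gtilde_ge: "3 ^ n \<le> card (Gtilde (Suc n))"
proof (induction n)
  case 0
  have "a2 \<in> Gtilde 1"
    using shift_mem_Gn[of 0 0 a2] corners_subset_Gn[of 0]
    by (auto simp: Gtilde_eq corners_def pt_eq_iff)
  then have "card (Gtilde 1) > 0" by (subst card_gt_0_iff) auto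
  then show ?case by simp
next
  case (Suc n)
  then show ?case using card_Gtilde_Suc(1)[of "Suc n"] by simp
qed

lemma card_Gn_minus_Gtilde: "card (Gn n - Gtilde n) \<le> 3"
proof -
  have "card (Gn n - Gtilde n) \<le> card (corners n)" by (intro card_mono) (auto simp: Gtilde_eq)
  then show ?thesis by (simp add: card_corners)
qed

lemma card_Gn: "card (Gtilde n) \<le> card (Gn n)" "card (Gn n) \<le> card (Gtilde n) + 3"
proof -
  show "card (Gtilde n) \<le> card (Gn n)" by (intro card_mono Gtilde_subset) simp
  have "card (Gn n) \<le> card (Gtilde n \<union> (Gn n - Gtilde n))" by (intro card_mono) auto
  also have "\<dots> \<le> card (Gtilde n) + card (Gn n - Gtilde n)" by (rule card_Un_le)
  finally show "card (Gn n) \<le> card (Gtilde n) + 3" using card_Gn_minus_Gtilde[of n] by simp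
qed

section \<open>Balls as two mirror-image triangles\<close>

lemma BL_eq: "BL n = Gn n \<union> mir ` Gn n"
  by (simp add: BL_def Gn'_def)

lemma finite_BL [simp]: "finite (BL n)"
  by (simp add: BL_eq)

lemma BL_subset_SG: "BL n \<subseteq> SG"
  by (auto simp: BL_def SG_def)

lemma Gn_Int_mir: "x \<in> Gn n \<Longrightarrow> mir x \<in> Gn m \<Longrightarrow> x = 0"
  using Gn_coords[of x n] Gn_coords[of "mir x" m] by (simp add: pt_eq_iff)

lemma card_BL: "card (BL n) \<le> 2 * card (Gn n)" "2 * card (Gn n) \<le> card (BL n) + 1"
proof -
  have c: "card (mir ` Gn n) = card (Gn n)" by (simp add: card_image inj_mir)
  have "card (Gn n) + card (mir ` Gn n) = card (BL n) + card (Gn n \<inter> mir ` Gn n)"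
    unfolding BL_eq by (rule card_Un_Int) auto
  moreover have "card (Gn n \<inter> mir ` Gn n) \<le> card {0 :: pt}"
  proof (rule card_mono)
    show "Gn n \<inter> mir ` Gn n \<subseteq> {0}"
    proof
      fix x assume "x \<in> Gn n \<inter> mir ` Gn n"
      then have "x \<in> Gn n" "mir x \<in> Gn n" by (metis IntD1, metis IntD2 image_iff mir_mir)
      then show "x \<in> {0}" using Gn_Int_mir by simp
    qed
  qed simp
  ultimately show "card (BL n) \<le> 2 * card (Gn n)" "2 * card (Gn n) \<le> card (BL n) + 1"
    using c by auto
qed

lemma Gtilde_mir_disjoint: "Gtilde n \<inter> mir ` Gtilde n = {}"
proof -
  have "mir x \<notin> Gtilde n" if x: "x \<in> Gtilde n" for x
    using Gn_Int_mir[of x n n] x zero_in_corners[of n] by (auto simp: Gtilde_eq)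
  then show ?thesis by auto
qed

lemma adj_across_mirror:
  assumes x: "x \<in> Gtilde n" and y: "y \<in> Gtilde n"
  shows "\<not> adj x (mir y)"
proof
  assume "adj x (mir y)"
  then have "mir y \<in> Gn n" by (rule Gtilde_neighbour_in_Gn[OF x])
  then have "y = 0" using Gn_Int_mir[of y n n] y by (auto simp: Gtilde_eq)
  then show False using y zero_in_corners by (simp add: Gtilde_eq)
qed

lemma card_BL_minus: "card (BL n - (Gtilde n \<union> mir ` Gtilde n)) \<le> 6"
proof -
  have "card (BL n - (Gtilde n \<union> mir ` Gtilde n)) \<le> card ((Gn n - Gtilde n) \<union> mir ` (Gn n - Gtilde n))"
    by (intro card_mono) (auto simp: BL_eq)
  also have "\<dots> \<le> card (Gn n - Gtilde n) + card (mir ` (Gn n - Gtilde n))" by (rule card_Un_le)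
  also have "\<dots> \<le> 6"
    using card_Gn_minus_Gtilde[of n] by (simp add: card_image inj_mir)
  finally show ?thesis .
qed

lemma deg_in_BL_eq_deg:
  assumes "x \<in> Gtilde n \<union> mir ` Gtilde n"
  shows "deg_in (BL n) x = deg x"
proof -
  have 1: "deg_in (BL n) y = deg y" if "y \<in> Gtilde n" for y
    using that by (rule deg_in_eq_deg) (simp_all add: BL_subset_SG, simp add: BL_eq)
  have 2: "deg_in (BL n) (mir y) = deg_in (BL n) y" for y
  proof -
    have BL: "mir z \<in> BL n" if "z \<in> BL n" for z using that by (auto simp: BL_eq)
    have "{z \<in> BL n. adj (mir y) z} = mir ` {z \<in> BL n. adj y z}"
    proof (intro equalityI subsetI)
      fix z assume "z \<in> {z \<in> BL n. adj (mir y) z}"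
      then show "z \<in> mir ` {z \<in> BL n. adj y z}"
        using adj_mir[of y "mir z"] BL by (intro image_eqI[of _ _ "mir z"]) auto
      next
      fix z assume "z \<in> mir ` {z \<in> BL n. adj y z}"
      then obtain w where "w \<in> BL n" "adj y w" "z = mir w" by blast
      then show "z \<in> {z \<in> BL n. adj (mir y) z}" using adj_mir BL by simp
    qed
    then show ?thesis by (simp add: deg_in_def card_image inj_mir)
  qed
  show ?thesis using assms by (elim UnE imageE) (simp_all add: 1 2 deg_mir)
qed

subsection \<open>Counting functions on the Sierpinski lattice\<close>

lemma sym_on_Hker: "sym_on A (Hker B b v)"
  by (auto simp: sym_on_def Hker_def adj_sym)

text \<open>The simple diagonal uses the full lattice degree, so \<open>Hker {} Simple v\<close>
  stands for one kernel that is restricted to every set below.\<close>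

lemma Hker_Simple: "Hker A Simple v = Hker B Simple v"
  by (simp add: Hker_def diag_bc_def fun_eq_iff)

text \<open>The three diagonals differ by multiples of \<open>deg x - deg_in A x\<close>, so they
  agree wherever no neighbour is missing.\<close>

lemma Hker_eq_Simple:
  assumes "deg_in A x = deg x"
  shows "Hker A b v x y = Hker B Simple v x y"
proof -
  have "diag_bc b A x = diag_bc Simple B x" using assms by (cases b) (simp_all add: diag_bc_def)
  then show ?thesis unfolding Hker_def by (rule arg_cong)
qed

lemma Ncount_cong:
  assumes "finite A" "\<And>x. x \<in> A \<Longrightarrow> v x = w x"
  shows "Ncount E A b v = Ncount E A b w"
  unfolding Ncount_def using assms by (intro Nev_cong) (auto simp: Hker_def)

lemma Ncount_le_card: "finite A \<Longrightarrow> Ncount E A b v \<le> card A"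
  unfolding Ncount_def by (rule Nev_le_card[OF _ sym_on_Hker])

text \<open>The reference count to which all other counts are compared: additive over blocks up to a
  bounded error, with block counts that read the potential on disjoint sets.\<close>

definition cnt :: "real \<Rightarrow> nat \<Rightarrow> (pt \<Rightarrow> real) \<Rightarrow> real" where
  "cnt E n v = real (Ncount E (Gtilde n) Simple v)"

lemma cnt_cong: "(\<And>x. x \<in> Gtilde n \<Longrightarrow> v x = w x) \<Longrightarrow> cnt E n v = cnt E n w"
  unfolding cnt_def by (rule arg_cong[of _ _ real], rule Ncount_cong) auto

lemma cnt_bounds: "0 \<le> cnt E n v" "cnt E n v \<le> real (card (Gtilde n))"
  using Ncount_le_card[OF finite_Gtilde] by (simp_all add: cnt_def)

lemma Nev_image_Gtilde:
  assumes g: "inj_on g (Gtilde n)"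
    and adj: "\<And>x y. x \<in> Gtilde n \<Longrightarrow> y \<in> Gtilde n \<Longrightarrow> adj (g x) (g y) \<longleftrightarrow> adj x y"
    and deg: "\<And>x. x \<in> Gtilde n \<Longrightarrow> deg (g x) = deg x"
  shows "real (Nev E (g ` Gtilde n) (Hker B Simple v)) = cnt E n (\<lambda>x. v (g x))"
proof -
  have "Nev E (g ` Gtilde n) (Hker B Simple v) = Nev E (Gtilde n) (\<lambda>x y. Hker B Simple v (g x) (g y))"
    by (rule Nev_image[OF finite_Gtilde g sym_on_Hker])
  also have "\<dots> = Ncount E (Gtilde n) Simple (\<lambda>x. v (g x))"
    unfolding Ncount_def
    using adj deg inj_on_eq_iff[OF g] by (intro Nev_cong) (simp_all add: Hker_def diag_bc_def)
  finally show ?thesis by (simp add: cnt_def)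
qed

lemma Nev_shift_block:
  "t \<in> corners n \<Longrightarrow> real (Nev E ((\<lambda>p. p + t) ` Gtilde n) (Hker B Simple v)) = cnt E n (\<lambda>x. v (x + t))"
proof (rule Nev_image_Gtilde)
  assume t: "t \<in> corners n"
  show "adj (x + t) (y + t) \<longleftrightarrow> adj x y" if "x \<in> Gtilde n" "y \<in> Gtilde n" for x y
    using that Gtilde_subset[of n] by (intro adj_shift[OF _ _ t]) blast+
  show "deg (x + t) = deg x" if "x \<in> Gtilde n" for x using that t by (rule deg_shift)
qed simp

lemma Nev_mirror_block:
  "real (Nev E (mir ` Gtilde n) (Hker B Simple v)) = cnt E n (\<lambda>x. v (mir x))"
  by (rule Nev_image_Gtilde) (simp_all add: inj_mir adj_mir deg_mir)

lemma Nev_UN_uncoupled: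
  assumes "finite T" "\<And>t. t \<in> T \<Longrightarrow> finite (B t)" "\<And>A. sym_on A K"
    and "\<And>s t. s \<in> T \<Longrightarrow> t \<in> T \<Longrightarrow> s \<noteq> t \<Longrightarrow> B s \<inter> B t = {}"
    and "\<And>s t x y. s \<in> T \<Longrightarrow> t \<in> T \<Longrightarrow> s \<noteq> t \<Longrightarrow> x \<in> B s \<Longrightarrow> y \<in> B t \<Longrightarrow> K x y = 0"
  shows "Nev E (\<Union>t\<in>T. B t) K = (\<Sum>t\<in>T. Nev E (B t) K)"
  using assms(1,2,4,5)
proof (induction T rule: finite_induct)
  case empty
  then show ?case using Nev_le_card[of "{}" K E] assms(3) by simp
next
  case (insert t T)
  have IH: "Nev E (\<Union>t\<in>T. B t) K = (\<Sum>t\<in>T. Nev E (B t) K)"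
    using insert.prems by (intro insert.IH) blast+
  have "Nev E (B t \<union> (\<Union>t\<in>T. B t)) K = Nev E (B t) K + Nev E (\<Union>t\<in>T. B t) K"
  proof (rule Nev_Un_uncoupled)
    show "B t \<inter> (\<Union>t\<in>T. B t) = {}" using insert.prems(2) insert.hyps(2) by blast
    show "K x y = 0" if "x \<in> B t" "y \<in> (\<Union>t\<in>T. B t)" for x y
      using that insert.prems(3) insert.hyps(2) by blast
  qed (use insert assms(3) in auto)
  then show ?case using IH insert.hyps by simp
qed

lemma Nev_blocks:
  "real (Nev E (blocks n) (Hker B Simple v)) = (\<Sum>t\<in>corners n. cnt E n (\<lambda>x. v (x + t)))"
proof -
  have "Nev E (blocks n) (Hker B Simple v)
      = (\<Sum>t\<in>corners n. Nev E ((\<lambda>p. p + t) ` Gtilde n) (Hker B Simple v))"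
    unfolding blocks_def
  proof (rule Nev_UN_uncoupled)
    fix s t x y assume st: "s \<in> corners n" "t \<in> corners n" "s \<noteq> t"
    show disj: "(\<lambda>p. p + s) ` Gtilde n \<inter> (\<lambda>p. p + t) ` Gtilde n = {}"
      by (rule blocks_disjoint[OF st])
    assume xy: "x \<in> (\<lambda>p. p + s) ` Gtilde n" "y \<in> (\<lambda>p. p + t) ` Gtilde n"
    then obtain x' y' where "x' \<in> Gtilde n" "x = x' + s" "y' \<in> Gtilde n" "y = y' + t" by blast
    then have "\<not> adj x y" using adj_across_blocks[OF _ _ _ st] by (simp add: Gtilde_eq)
    moreover have "x \<noteq> y" using disj xy by blast
    ultimately show "Hker B Simple v x y = 0" by (simp add: Hker_def)
  qed (simp_all add: sym_on_Hker)
  then show ?thesis by (simp add: Nev_shift_block)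
qed

lemma cnt_Suc: "\<bar>cnt E (Suc n) v - (\<Sum>t\<in>corners n. cnt E n (\<lambda>x. v (x + t)))\<bar> \<le> 9"
proof -
  let ?K = "Hker {} Simple v"
  have "cnt E (Suc n) v = real (Nev E (Gtilde (Suc n)) ?K)"
    by (simp add: cnt_def Ncount_def Hker_Simple[of "Gtilde (Suc n)" v "{}"])
  moreover have "Nev E (blocks n) ?K \<le> Nev E (Gtilde (Suc n)) ?K"
    "Nev E (Gtilde (Suc n)) ?K \<le> Nev E (blocks n) ?K + card (Gtilde (Suc n) - blocks n)"
    using interlacing[OF finite_Gtilde blocks_subset sym_on_Hker] by blast+
  ultimately show ?thesis
    using card_Gtilde_minus_blocks[of n] unfolding Nev_blocks[symmetric, of E n v "{}"] by linarith
qed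

text \<open>The common part is \<open>Gtilde n\<close> for the full triangle, at a cost of 3 points,
  and \<open>Gcore n\<close> for the truncated one, at a cost of 18.\<close>

lemma Ncount_region_close: "\<bar>real (Ncount E (region_set r n) b v) - cnt E n v\<bar> \<le> 18"
proof -
  have "\<bar>real (Nev E (region_set r n) (Hker (region_set r n) b v))
      - real (Nev E (Gtilde n) (Hker (Gtilde n) Simple v))\<bar> \<le> real 18"
  proof (cases r)
    case Full
    show ?thesis unfolding region_set_def Full region.case
    proof (rule Nev_close_of_common_part[where C = "Gtilde n"])
      fix x y assume "x \<in> Gtilde n" "y \<in> Gtilde n"
      then show "Hker (Gn n) b v x y = Hker (Gtilde n) Simple v x y"
        using Gn_subset_SG by (intro Hker_eq_Simple deg_in_eq_deg[of x n]) auto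
    qed (use card_Gn_minus_Gtilde[of n] Gtilde_subset in \<open>auto simp: sym_on_Hker\<close>)
  next
    case Truncated
    show ?thesis unfolding region_set_def Truncated region.case
    proof (rule Nev_close_of_common_part[where C = "Gcore n"])
      fix x y assume "x \<in> Gcore n" "y \<in> Gcore n"
      then show "Hker (Gtilde n) b v x y = Hker (Gtilde n) Simple v x y"
        by (intro Hker_eq_Simple deg_in_Gtilde_eq_deg)
    qed (use card_Gtilde_minus_Gcore[of n] in \<open>auto simp: sym_on_Hker Gcore_def\<close>)
  qed
  then show ?thesis by (simp add: Ncount_def cnt_def)
qed

lemma Ncount_BL_close:
  "\<bar>real (Ncount E (BL n) b v) - (cnt E n v + cnt E n (\<lambda>x. v (mir x)))\<bar> \<le> 6"
proof -
  let ?D = "Gtilde n \<union> mir ` Gtilde n" and ?K = "Hker {} Simple v"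
  have sub: "?D \<subseteq> BL n" using Gtilde_subset by (auto simp: BL_eq)
  have "\<bar>real (Nev E (BL n) (Hker (BL n) b v)) - real (Nev E ?D ?K)\<bar> \<le> real 6"
  proof (rule Nev_close_of_common_part[where C = ?D])
    fix x y assume "x \<in> ?D" "y \<in> ?D"
    then show "Hker (BL n) b v x y = ?K x y"
      by (intro Hker_eq_Simple deg_in_BL_eq_deg)
  qed (use card_BL_minus[of n] sub in \<open>auto simp: sym_on_Hker\<close>)
  moreover have "Nev E ?D ?K = Nev E (Gtilde n) ?K + Nev E (mir ` Gtilde n) ?K"
  proof (rule Nev_Un_uncoupled)
    fix x y assume xy: "x \<in> Gtilde n" "y \<in> mir ` Gtilde n"
    then obtain y' where "y' \<in> Gtilde n" "y = mir y'" by blast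
    then have "\<not> adj x y" using adj_across_mirror xy by simp
    moreover have "x \<noteq> y" using xy Gtilde_mir_disjoint[of n] by blast
    ultimately show "?K x y = 0" by (simp add: Hker_def)
  qed (simp_all add: sym_on_Hker Gtilde_mir_disjoint)
  moreover have "cnt E n v = real (Nev E (Gtilde n) ?K)"
    by (simp add: cnt_def Ncount_def Hker_Simple[of "Gtilde n" v "{}"])
  ultimately show ?thesis by (simp add: Ncount_def Nev_mirror_block)
qed

subsection \<open>Measurability\<close>

text \<open>By upper semicontinuity the potentials with count at most \<open>m\<close> form an open
  set in finitely many coordinates. It is a countable union of cubes with rational centres, and each
  cube has a measurable preimage.\<close>

lemma borel_measurable_Ncount:
  assumes A: "finite A" and X: "\<And>x. x \<in> A \<Longrightarrow> X x \<in> borel_measurable M"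
  shows "(\<lambda>\<omega>. real (Ncount E A b (\<lambda>x. X x \<omega>))) \<in> borel_measurable M"
proof -
  define near where "near = (\<lambda>(v :: pt \<Rightarrow> real) (q :: pt \<Rightarrow> real) (k :: nat). \<forall>x\<in>A. \<bar>v x - q x\<bar> < 1 / real (Suc k))"
  have "{\<omega> \<in> space M. Ncount E A b (\<lambda>x. X x \<omega>) \<le> m} \<in> sets M" for m
  proof -
    define Q where "Q = {(q, k). q \<in> (\<Pi>\<^sub>E x\<in>A. \<rat>) \<and> (\<forall>v. near v q k \<longrightarrow> Ncount E A b v \<le> m)}"
    have "countable ((\<Pi>\<^sub>E x\<in>A. \<rat> :: real set) \<times> (UNIV :: nat set))"
      using A countable_rat by (intro countable_SIGMA countable_PiE) auto
    then have Q: "countable Q" by (rule countable_subset[rotated]) (auto simp: Q_def)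
    have "{\<omega> \<in> space M. Ncount E A b (\<lambda>x. X x \<omega>) \<le> m}
        = (\<Union>(q, k)\<in>Q. {\<omega> \<in> space M. near (\<lambda>x. X x \<omega>) q k})"
    proof (intro equalityI subsetI)
      fix \<omega> assume "\<omega> \<in> {\<omega> \<in> space M. Ncount E A b (\<lambda>x. X x \<omega>) \<le> m}"
      then have w: "\<omega> \<in> space M" and le: "Ncount E A b (\<lambda>x. X x \<omega>) \<le> m" by auto
      obtain d where d: "d > 0" "\<And>K'. sym_on A K' \<Longrightarrow>
          (\<And>x y. x \<in> A \<Longrightarrow> y \<in> A \<Longrightarrow> x \<noteq> y \<Longrightarrow> K' x y = Hker A b (\<lambda>x. X x \<omega>) x y) \<Longrightarrow>
          (\<And>x. x \<in> A \<Longrightarrow> \<bar>K' x x - Hker A b (\<lambda>x. X x \<omega>) x x\<bar> \<le> d) \<Longrightarrow>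
          Nev E A K' \<le> Nev E A (Hker A b (\<lambda>x. X x \<omega>))"
        using Nev_upper_semicontinuous[OF A sym_on_Hker, of A b "\<lambda>x. X x \<omega>" E] by metis
      \<comment> \<open>Half of \<open>d\<close>, since two errors add up: from \<open>v\<close> to
        the rational centre, and from the centre to the given potential.\<close>
      obtain k where k: "1 / real (Suc k) < d / 2"
        using nat_approx_posE[of "d / 2"] d(1) by auto
      have "\<exists>q\<in>\<rat>. \<bar>X x \<omega> - q\<bar> < 1 / real (Suc k)" for x
      proof -
        obtain q where "q \<in> \<rat>" "X x \<omega> - 1 / real (Suc k) < q" "q < X x \<omega>"
          using Rats_dense_in_real[of "X x \<omega> - 1 / real (Suc k)" "X x \<omega>"] by auto
        then show ?thesis by (intro bexI[of _ q]) auto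
      qed
      then obtain q0 where q0: "\<And>x. q0 x \<in> \<rat>" "\<And>x. \<bar>X x \<omega> - q0 x\<bar> < 1 / real (Suc k)" by metis
      define q where "q = restrict q0 A"
      have "Ncount E A b v \<le> m" if v: "near v q k" for v
      proof -
        have "Ncount E A b v \<le> Ncount E A b (\<lambda>x. X x \<omega>)"
          unfolding Ncount_def
        proof (rule d(2)[OF sym_on_Hker])
          fix x assume x: "x \<in> A"
          have "\<bar>v x - q0 x\<bar> < 1 / real (Suc k)" using v x by (simp add: near_def q_def)
          then have "\<bar>v x - X x \<omega>\<bar> \<le> d" using q0(2)[of x] k by linarith
          then show "\<bar>Hker A b v x x - Hker A b (\<lambda>x. X x \<omega>) x x\<bar> \<le> d" by (simp add: Hker_def)
        qed (simp add: Hker_def)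
        then show ?thesis using le by simp
      qed
      then have "(q, k) \<in> Q" using q0(1) by (auto simp: Q_def q_def)
      moreover have "near (\<lambda>x. X x \<omega>) q k" using q0(2) by (simp add: near_def q_def)
      ultimately show "\<omega> \<in> (\<Union>(q, k)\<in>Q. {\<omega> \<in> space M. near (\<lambda>x. X x \<omega>) q k})" using w by auto
    qed (auto simp: Q_def)
    moreover have "{\<omega> \<in> space M. near (\<lambda>x. X x \<omega>) q k} \<in> sets M" for q k
    proof -
      have "{\<omega> \<in> space M. \<bar>X x \<omega> - q x\<bar> < 1 / real (Suc k)} \<in> sets M" if "x \<in> A" for x
        using X[OF that] by measurable
      then show ?thesis unfolding near_def using A by (intro sets.sets_Collect_finite_All) auto
    qed
    ultimately show ?thesis using Q by (auto intro!: sets.countable_UN')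
  qed
  note meas = this
  show ?thesis
  proof (rule borel_measurable_iff_le[THEN iffD2], rule allI)
    fix a :: real
    have "{\<omega> \<in> space M. real (Ncount E A b (\<lambda>x. X x \<omega>)) \<le> a}
        = (if a < 0 then {} else {\<omega> \<in> space M. Ncount E A b (\<lambda>x. X x \<omega>) \<le> nat \<lfloor>a\<rfloor>})"
      by (auto simp: le_nat_floor) linarith
    then show "{\<omega> \<in> space M. real (Ncount E A b (\<lambda>x. X x \<omega>)) \<le> a} \<in> sets M"
      using meas by simp
  qed
qed

lemma borel_measurable_cnt:
  "(\<And>x. x \<in> Gtilde n \<Longrightarrow> X x \<in> borel_measurable M) \<Longrightarrow> (\<lambda>\<omega>. cnt E n (\<lambda>x. X x \<omega>)) \<in> borel_measurable M"
  unfolding cnt_def by (rule borel_measurable_Ncount) auto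

subsection \<open>Limits along the hierarchy\<close>

text \<open>Consecutive values of \<open>a n / 3 ^ n\<close> differ by at most
  \<open>C / 3 ^ (n + 1)\<close>, so the telescoping series converges absolutely.\<close>

lemma convergent_of_tripling:
  fixes a :: "nat \<Rightarrow> real"
  assumes "\<And>n. \<bar>a (Suc n) - 3 * a n\<bar> \<le> C"
  shows "convergent (\<lambda>n. a n / 3 ^ n)"
proof -
  have "summable (\<lambda>n. a (Suc n) / 3 ^ Suc n - a n / 3 ^ n)"
  proof (rule summable_comparison_test')
    show "summable (\<lambda>n. C / 3 * (1 / 3) ^ n)" by (intro summable_mult summable_geometric) simp
    show "norm (a (Suc n) / 3 ^ Suc n - a n / 3 ^ n) \<le> C / 3 * (1 / 3) ^ n" for n
    proof -
      have "a (Suc n) / 3 ^ Suc n - a n / 3 ^ n = (a (Suc n) - 3 * a n) / 3 ^ Suc n"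
        by (simp add: field_simps)
      also have "norm \<dots> \<le> C / 3 ^ Suc n"
        using assms[of n] by (simp add: divide_right_mono)
      finally show ?thesis by (simp add: power_divide)
    qed
  qed
  moreover have "(\<Sum>i<n. a (Suc i) / 3 ^ Suc i - a i / 3 ^ i) = a n / 3 ^ n - a 0" for n
    using sum_lessThan_telescope[of "\<lambda>n. a n / 3 ^ n" n] by simp
  ultimately have "convergent (\<lambda>n. a n / 3 ^ n - a 0)" by (simp only: summable_iff_convergent)
  then have "convergent (\<lambda>n. (a n / 3 ^ n - a 0) + a 0)" by (intro convergent_add convergent_const)
  then show ?thesis by simp
qed

lemma bounded_over_3_pow:
  fixes x :: "nat \<Rightarrow> real"
  assumes "\<And>n. \<bar>x n\<bar> \<le> C"
  shows "(\<lambda>n. x n / 3 ^ n) \<longlonglongrightarrow> 0"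
proof (rule Lim_null_comparison)
  show "eventually (\<lambda>n. norm (x n / 3 ^ n) \<le> C * (1 / 3) ^ n) sequentially"
    using assms by (simp add: power_divide divide_right_mono)
  show "(\<lambda>n. C * (1 / 3) ^ n) \<longlonglongrightarrow> 0"
    by (intro tendsto_mult_right_zero LIMSEQ_power_zero) simp
qed

lemma ratio_limit:
  fixes x a c :: "nat \<Rightarrow> real"
  assumes "(\<lambda>n. a n / 3 ^ n) \<longlonglongrightarrow> e" "(\<lambda>n. c n / 3 ^ n) \<longlonglongrightarrow> k" "k \<noteq> 0"
    and "\<And>n. \<bar>x n - a n\<bar> \<le> C"
  shows "(\<lambda>n. x n / c n) \<longlonglongrightarrow> e / k"
proof -
  have "(\<lambda>n. (x n - a n) / 3 ^ n + a n / 3 ^ n) \<longlonglongrightarrow> 0 + e"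
    by (intro tendsto_add bounded_over_3_pow[where C = C] assms)
  then have "(\<lambda>n. x n / 3 ^ n) \<longlonglongrightarrow> e" by (simp add: diff_divide_distrib)
  then have "(\<lambda>n. (x n / 3 ^ n) / (c n / 3 ^ n)) \<longlonglongrightarrow> e / k" by (intro tendsto_divide assms)
  then show ?thesis by simp
qed

lemma card_limit:
  obtains k where "k \<noteq> 0" "(\<lambda>n. real (card (Gn n)) / 3 ^ n) \<longlonglongrightarrow> k"
    "(\<lambda>n. real (card (BL n)) / 3 ^ n) \<longlonglongrightarrow> 2 * k"
proof -
  let ?d = "\<lambda>n. real (card (Gtilde n))"
  have "\<bar>?d (Suc n) - 3 * ?d n\<bar> \<le> 9" for n using card_Gtilde_Suc[of n] by linarith
  then obtain k where k: "(\<lambda>n. ?d n / 3 ^ n) \<longlonglongrightarrow> k"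
    using convergent_of_tripling[of ?d 9] by (auto simp: convergent_def)
  have "1 / 3 \<le> ?d (Suc n) / 3 ^ Suc n" for n
  proof -
    have "real (3 ^ n) \<le> ?d (Suc n)" using card_Gtilde_ge by (rule of_nat_mono)
    then show ?thesis by (simp add: field_simps)
  qed
  then have "1 / 3 \<le> k" using LIMSEQ_Suc[OF k] by (intro LIMSEQ_le_const) auto
  then have nz: "k \<noteq> 0" by simp
  have close: "(\<lambda>n. x n / 3 ^ n) \<longlonglongrightarrow> l" if "\<And>n. \<bar>x n - a n\<bar> \<le> C" "(\<lambda>n. a n / 3 ^ n) \<longlonglongrightarrow> l"
    for x a :: "nat \<Rightarrow> real" and C l
  proof -
    have "(\<lambda>n. (x n - a n) / 3 ^ n + a n / 3 ^ n) \<longlonglongrightarrow> 0 + l"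
      by (intro tendsto_add bounded_over_3_pow[of _ C] that)
    then show ?thesis by (simp add: diff_divide_distrib)
  qed
  have "\<bar>real (card (Gn n)) - ?d n\<bar> \<le> 3" for n using card_Gn[of n] by linarith
  then have G: "(\<lambda>n. real (card (Gn n)) / 3 ^ n) \<longlonglongrightarrow> k" using k by (rule close)
  have "\<bar>real (card (BL n)) - 2 * real (card (Gn n))\<bar> \<le> 1" for n using card_BL[of n] by linarith
  moreover have "(\<lambda>n. 2 * real (card (Gn n)) / 3 ^ n) \<longlonglongrightarrow> 2 * k"
    using tendsto_mult_left[OF G, of 2] by simp
  ultimately have "(\<lambda>n. real (card (BL n)) / 3 ^ n) \<longlonglongrightarrow> 2 * k" by (rule close)
  then show thesis using that nz G by blast
qed

subsection \<open>Independent potentials\<close>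

text \<open>The integral is over the product space rather than over \<open>M\<close>: it depends
  only on the single-site law, so shifted and mirrored copies share it.\<close>

definition cmean :: "real \<Rightarrow> real measure \<Rightarrow> nat \<Rightarrow> real" where
  "cmean E \<mu> n = (\<integral>v. cnt E n v \<partial>PiM (Gtilde n) (\<lambda>_. \<mu>))"

definition cvar :: "real \<Rightarrow> real measure \<Rightarrow> nat \<Rightarrow> real" where
  "cvar E \<mu> n = (\<integral>v. (cnt E n v - cmean E \<mu> n)\<^sup>2 \<partial>PiM (Gtilde n) (\<lambda>_. \<mu>))"

locale iid_potential = prob_space M for M :: "'w measure" +
  fixes V :: "pt \<Rightarrow> 'w \<Rightarrow> real" and \<mu> :: "real measure"
  assumes V_measurable: "\<And>x. x \<in> SG \<Longrightarrow> V x \<in> borel_measurable M"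
    and V_indep: "indep_vars (\<lambda>_. borel) V SG"
    and V_distr: "\<And>x. x \<in> SG \<Longrightarrow> distr M borel (V x) = \<mu>"
begin

lemma prob_space_\<mu>: "prob_space \<mu>"
proof -
  have "0 \<in> SG" using zero_in_corners corners_subset_Gn Gn_subset_SG by blast
  then show ?thesis using prob_space_distr[OF V_measurable] V_distr by metis
qed

lemma sets_\<mu> [simp]: "sets \<mu> = sets borel"
proof -
  have "0 \<in> SG" using zero_in_corners corners_subset_Gn Gn_subset_SG by blast
  then show ?thesis using V_distr[of 0] by (metis sets_distr)
qed

text \<open>Reading an i.i.d. field along an injective relabelling of sites does not change its
  joint law. Translations and the reflection are the relabellings used.\<close>

lemma distr_relabelled:
  assumes g: "inj_on g A" "g ` A \<subseteq> SG" and A: "finite A" "A \<noteq> {}"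
  shows "distr M (PiM A (\<lambda>_. \<mu>)) (\<lambda>\<omega>. \<lambda>x\<in>A. V (g x) \<omega>) = PiM A (\<lambda>_. \<mu>)"
proof -
  let ?B = "g ` A"
  have rv: "\<And>x. x \<in> ?B \<Longrightarrow> random_variable borel (V x)" using g V_measurable by auto
  have "distr M (PiM ?B (\<lambda>_. borel)) (\<lambda>\<omega>. \<lambda>x\<in>?B. V x \<omega>) = PiM ?B (\<lambda>x. distr M borel (V x))"
    using indep_vars_iff_distr_eq_PiM'[where I = ?B and M' = "\<lambda>_. borel" and X = V] indep_vars_subset[OF V_indep g(2)] A rv by auto
  also have "\<dots> = PiM ?B (\<lambda>_. \<mu>)" using g V_distr by (intro PiM_cong) auto
  finally have B: "PiM ?B (\<lambda>_. \<mu>) = distr M (PiM ?B (\<lambda>_. borel)) (\<lambda>\<omega>. \<lambda>x\<in>?B. V x \<omega>)" by simp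
  have "PiM A (\<lambda>_. \<mu>) = distr (PiM ?B (\<lambda>_. \<mu>)) (PiM A (\<lambda>_. \<mu>)) (\<lambda>\<omega>. \<lambda>x\<in>A. \<omega> (g x))"
    using distr_PiM_reindex[of ?B "\<lambda>_. \<mu>" g A] g prob_space_\<mu> by auto
  also have "\<dots> = distr M (PiM A (\<lambda>_. \<mu>)) ((\<lambda>\<omega>. \<lambda>x\<in>A. \<omega> (g x)) \<circ> (\<lambda>\<omega>. \<lambda>x\<in>?B. V x \<omega>))"
    unfolding B
  proof (rule distr_distr)
    show "(\<lambda>\<omega>. \<lambda>x\<in>A. \<omega> (g x)) \<in> PiM ?B (\<lambda>_. borel) \<rightarrow>\<^sub>M PiM A (\<lambda>_. \<mu>)"
    proof (rule measurable_restrict)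
      fix x assume "x \<in> A"
      then have "(\<lambda>\<omega>. \<omega> (g x)) \<in> PiM ?B (\<lambda>_. borel) \<rightarrow>\<^sub>M (borel :: real measure)"
        by (intro measurable_component_singleton) auto
      then show "(\<lambda>\<omega>. \<omega> (g x)) \<in> PiM ?B (\<lambda>_. borel) \<rightarrow>\<^sub>M \<mu>"
        using measurable_cong_sets[OF refl sets_\<mu>] by blast
    qed
    show "(\<lambda>\<omega>. \<lambda>x\<in>?B. V x \<omega>) \<in> M \<rightarrow>\<^sub>M PiM ?B (\<lambda>_. borel)"
      using rv by (rule measurable_restrict)
  qed
  also have "(\<lambda>\<omega>. \<lambda>x\<in>A. \<omega> (g x)) \<circ> (\<lambda>\<omega>. \<lambda>x\<in>?B. V x \<omega>) = (\<lambda>\<omega>. \<lambda>x\<in>A. V (g x) \<omega>)"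
    by (auto simp: fun_eq_iff)
  finally show ?thesis by (rule sym)
qed

lemma integral_cnt_relabelled:
  fixes h :: "real \<Rightarrow> real"
  assumes g: "inj_on g (Gtilde n)" "g ` Gtilde n \<subseteq> SG" and h: "h \<in> borel_measurable borel"
  shows "(\<integral>\<omega>. h (cnt E n (\<lambda>x. V (g x) \<omega>)) \<partial>M) = (\<integral>v. h (cnt E n v) \<partial>PiM (Gtilde n) (\<lambda>_. \<mu>))"
proof (cases "Gtilde n = {}")
  \<comment> \<open>This happens at level 0; \<open>distr_relabelled\<close> is stated for nonempty
    sets, and here the count is a constant.\<close>
  case True
  then have c: "cnt E n v = cnt E n (\<lambda>_. 0)" for v by (intro cnt_cong) simp
  interpret P: prob_space "PiM (Gtilde n) (\<lambda>_. \<mu>)" by (intro prob_space_PiM prob_space_\<mu>)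
  show ?thesis by (subst c, subst (2) c) (simp add: prob_space P.prob_space)
next
  case False
  let ?P = "PiM (Gtilde n) (\<lambda>_. \<mu>)"
  have comp: "(\<lambda>v. v x) \<in> borel_measurable ?P" if "x \<in> Gtilde n" for x
  proof -
    have "(\<lambda>v. v x) \<in> ?P \<rightarrow>\<^sub>M \<mu>" using that by (rule measurable_component_singleton)
    then show ?thesis using measurable_cong_sets[OF refl sets_\<mu>] by blast
  qed
  have meas: "(\<lambda>v. h (cnt E n v)) \<in> borel_measurable ?P"
    using borel_measurable_cnt[of n "\<lambda>x v. v x" ?P E] comp h by (simp add: measurable_compose[OF _ h])
  have "(\<integral>v. h (cnt E n v) \<partial>?P)
      = (\<integral>v. h (cnt E n v) \<partial>distr M ?P (\<lambda>\<omega>. \<lambda>x\<in>Gtilde n. V (g x) \<omega>))"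
    by (subst distr_relabelled[OF g finite_Gtilde False]) simp
  also have "\<dots> = (\<integral>\<omega>. h (cnt E n (\<lambda>x\<in>Gtilde n. V (g x) \<omega>)) \<partial>M)"
  proof (rule integral_distr[OF _ meas], rule measurable_restrict)
    fix x assume "x \<in> Gtilde n"
    then have "V (g x) \<in> borel_measurable M" using g(2) by (intro V_measurable) blast
    then show "V (g x) \<in> M \<rightarrow>\<^sub>M \<mu>" using measurable_cong_sets[OF refl sets_\<mu>] by blast
  qed
  also have "\<dots> = (\<integral>\<omega>. h (cnt E n (\<lambda>x. V (g x) \<omega>)) \<partial>M)"
    by (intro Bochner_Integration.integral_cong refl arg_cong[of _ _ h] cnt_cong) simp
  finally show ?thesis by simp
qed

lemma expectation_cnt:
  assumes "inj_on g (Gtilde n)" "g ` Gtilde n \<subseteq> SG"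
  shows "expectation (\<lambda>\<omega>. cnt E n (\<lambda>x. V (g x) \<omega>)) = cmean E \<mu> n"
    and "expectation (\<lambda>\<omega>. (cnt E n (\<lambda>x. V (g x) \<omega>) - cmean E \<mu> n)\<^sup>2) = cvar E \<mu> n"
  using integral_cnt_relabelled[OF assms, of "\<lambda>x. x" E]
    integral_cnt_relabelled[OF assms, of "\<lambda>x. (x - cmean E \<mu> n)\<^sup>2" E]
  by (simp_all add: cmean_def cvar_def)

lemma measurable_cnt:
  "g ` Gtilde n \<subseteq> SG \<Longrightarrow> (\<lambda>\<omega>. cnt E n (\<lambda>x. V (g x) \<omega>)) \<in> borel_measurable M"
  by (intro borel_measurable_cnt V_measurable) blast

lemma integrable_cnt:
  "g ` Gtilde n \<subseteq> SG \<Longrightarrow> integrable M (\<lambda>\<omega>. cnt E n (\<lambda>x. V (g x) \<omega>))"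
  using cnt_bounds by (intro integrable_const_bound[of _ "real (card (Gtilde n))"] measurable_cnt) auto

lemma integrable_Ncount:
  assumes "finite A" "A \<subseteq> SG"
  shows "integrable M (\<lambda>\<omega>. real (Ncount E A b (\<lambda>x. V x \<omega>)))"
  using assms Ncount_le_card[OF assms(1)] V_measurable
  by (intro integrable_const_bound[of _ "real (card A)"] borel_measurable_Ncount) auto

section \<open>Recursions for mean and variance\<close>

lemma expectation_close:
  fixes f g :: "'w \<Rightarrow> real"
  assumes "integrable M f" "integrable M g" "\<And>\<omega>. \<bar>f \<omega> - g \<omega>\<bar> \<le> C"
  shows "\<bar>expectation f - expectation g\<bar> \<le> C"
proof -
  have "\<bar>expectation f - expectation g\<bar> = \<bar>expectation (\<lambda>\<omega>. f \<omega> - g \<omega>)\<bar>" using assms by simp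
  also have "\<dots> \<le> expectation (\<lambda>\<omega>. \<bar>f \<omega> - g \<omega>\<bar>)" by (rule integral_abs_bound)
  also have "\<dots> \<le> expectation (\<lambda>\<omega>. C)" using assms by (intro integral_mono) auto
  finally show ?thesis by (simp add: prob_space)
qed

lemma shift_Gtilde_subset_SG: "t \<in> corners n \<Longrightarrow> (\<lambda>x. x + t) ` Gtilde n \<subseteq> SG"
  using shift_mem_Gtilde Gtilde_subset Gn_subset_SG by blast

lemma Gtilde_subset_SG: "Gtilde n \<subseteq> SG"
  using Gtilde_subset Gn_subset_SG by blast

lemma cmean_Suc: "\<bar>cmean E \<mu> (Suc n) - 3 * cmean E \<mu> n\<bar> \<le> 9"
proof -
  have "expectation (\<lambda>\<omega>. \<Sum>t\<in>corners n. cnt E n (\<lambda>x. V (x + t) \<omega>))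
      = (\<Sum>t\<in>corners n. expectation (\<lambda>\<omega>. cnt E n (\<lambda>x. V (x + t) \<omega>)))"
    using integrable_cnt shift_Gtilde_subset_SG by (intro Bochner_Integration.integral_sum) auto
  also have "\<dots> = (\<Sum>t\<in>corners n. cmean E \<mu> n)"
    using expectation_cnt(1) shift_Gtilde_subset_SG by (intro sum.cong refl) auto
  also have "\<dots> = 3 * cmean E \<mu> n" by (simp add: card_corners)
  finally have S: "expectation (\<lambda>\<omega>. \<Sum>t\<in>corners n. cnt E n (\<lambda>x. V (x + t) \<omega>)) = 3 * cmean E \<mu> n" .
  have "\<bar>expectation (\<lambda>\<omega>. cnt E (Suc n) (\<lambda>x. V x \<omega>))
      - expectation (\<lambda>\<omega>. \<Sum>t\<in>corners n. cnt E n (\<lambda>x. V (x + t) \<omega>))\<bar> \<le> 9"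
    using integrable_cnt[of "\<lambda>x. x"] integrable_cnt[OF shift_Gtilde_subset_SG] Gtilde_subset_SG
    by (intro expectation_close cnt_Suc Bochner_Integration.integrable_sum) auto
  then show ?thesis using S expectation_cnt(1)[of "\<lambda>x. x" "Suc n"] Gtilde_subset_SG by simp
qed

text \<open>Distinct truncated blocks share no site, so their counts are functions of independent
  subfamilies of the potential, and the covariance factorises into centred means.\<close>

lemma expectation_product_blocks:
  assumes st: "s \<in> corners n" "t \<in> corners n" "s \<noteq> t"
  shows "expectation (\<lambda>\<omega>. (cnt E n (\<lambda>x. V (x + s) \<omega>) - cmean E \<mu> n) * (cnt E n (\<lambda>x. V (x + t) \<omega>) - cmean E \<mu> n)) = 0"
proof -
  let ?B = "\<lambda>t. (\<lambda>x. x + t) ` Gtilde n"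
  let ?F = "\<lambda>t \<phi>. cnt E n (\<lambda>x. \<phi> (x + t)) - cmean E \<mu> n"
  let ?Z = "\<lambda>t \<omega>. cnt E n (\<lambda>x. V (x + t) \<omega>) - cmean E \<mu> n"
  have F: "?F t \<in> PiM (?B t) (\<lambda>_. borel) \<rightarrow>\<^sub>M borel" for t
    by (intro borel_measurable_diff borel_measurable_cnt measurable_component_singleton) auto
  have eq: "?F t \<circ> (\<lambda>\<omega>. restrict (\<lambda>x. V x \<omega>) (?B t)) = ?Z t" for t
  proof
    fix \<omega>
    have "cnt E n (\<lambda>x. restrict (\<lambda>x. V x \<omega>) (?B t) (x + t)) = cnt E n (\<lambda>x. V (x + t) \<omega>)"
      by (rule cnt_cong) simp
    then show "(?F t \<circ> (\<lambda>\<omega>. restrict (\<lambda>x. V x \<omega>) (?B t))) \<omega> = ?Z t \<omega>" by simp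
  qed
  have "indep_var (PiM (?B s) (\<lambda>_. borel)) (\<lambda>\<omega>. restrict (\<lambda>x. V x \<omega>) (?B s))
      (PiM (?B t) (\<lambda>_. borel)) (\<lambda>\<omega>. restrict (\<lambda>x. V x \<omega>) (?B t))"
    by (rule indep_var_restrict[OF V_indep blocks_disjoint[OF st]]) (rule shift_Gtilde_subset_SG st)+
  from indep_var_compose[OF this F F] have "indep_var borel (?Z s) borel (?Z t)" unfolding eq .
  moreover have int: "integrable M (?Z t)" if "t \<in> corners n" for t
    using integrable_cnt[OF shift_Gtilde_subset_SG[OF that]] by simp
  ultimately have "expectation (\<lambda>\<omega>. ?Z s \<omega> * ?Z t \<omega>) = expectation (?Z s) * expectation (?Z t)"
    using st by (intro indep_var_lebesgue_integral) auto
  also have "expectation (?Z s) = 0"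
    using integrable_cnt[OF shift_Gtilde_subset_SG[OF st(1)]] shift_Gtilde_subset_SG[OF st(1)]
    by (simp add: expectation_cnt(1) prob_space)
  finally show ?thesis by simp
qed

text \<open>Uncorrelated blocks give \<open>3 * cvar E \<mu> n\<close>. The bounded error is
  correlated with the block sum, so its cross term is traded for a factor 4/3.\<close>

lemma cvar_Suc: "cvar E \<mu> (Suc n) \<le> 4 * cvar E \<mu> n + 1296"
proof -
  let ?Z = "\<lambda>t \<omega>. cnt E n (\<lambda>x. V (x + t) \<omega>) - cmean E \<mu> n"
  let ?Y = "\<lambda>\<omega>. cnt E (Suc n) (\<lambda>x. V x \<omega>) - cmean E \<mu> (Suc n)"
  let ?S = "\<lambda>\<omega>. \<Sum>t\<in>corners n. ?Z t \<omega>"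
  have bd: "\<bar>cnt E n v - cmean E \<mu> n\<bar> \<le> real (card (Gtilde n)) + \<bar>cmean E \<mu> n\<bar>" for n v
    using cnt_bounds[of E n v] by linarith
  have mZ: "?Z t \<in> borel_measurable M" if "t \<in> corners n" for t
    using measurable_cnt[OF shift_Gtilde_subset_SG[OF that]] by measurable
  have mY: "?Y \<in> borel_measurable M"
    using measurable_cnt[of "\<lambda>x. x" "Suc n"] Gtilde_subset_SG by simp
  have iZZ: "integrable M (\<lambda>\<omega>. ?Z s \<omega> * ?Z t \<omega>)" if "s \<in> corners n" "t \<in> corners n" for s t
  proof (rule integrable_const_bound[of _ "(real (card (Gtilde n)) + \<bar>cmean E \<mu> n\<bar>)\<^sup>2"])
    show "AE \<omega> in M. norm (?Z s \<omega> * ?Z t \<omega>) \<le> (real (card (Gtilde n)) + \<bar>cmean E \<mu> n\<bar>)\<^sup>2"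
      unfolding real_norm_def abs_mult power2_eq_square by (intro always_eventually allI mult_mono bd) auto
  qed (use mZ[OF that(1)] mZ[OF that(2)] in measurable)
  have iY: "integrable M (\<lambda>\<omega>. (?Y \<omega>)\<^sup>2)"
  proof (rule integrable_const_bound[of _ "(real (card (Gtilde (Suc n))) + \<bar>cmean E \<mu> (Suc n)\<bar>)\<^sup>2"])
    show "AE \<omega> in M. norm ((?Y \<omega>)\<^sup>2) \<le> (real (card (Gtilde (Suc n))) + \<bar>cmean E \<mu> (Suc n)\<bar>)\<^sup>2"
      unfolding real_norm_def abs_mult power2_eq_square by (intro always_eventually allI mult_mono bd) auto
  qed (use mY in measurable)
  have SS: "(?S \<omega>)\<^sup>2 = (\<Sum>s\<in>corners n. \<Sum>t\<in>corners n. ?Z s \<omega> * ?Z t \<omega>)" for \<omega>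
    unfolding power2_eq_square sum_product ..
  have "expectation (\<lambda>\<omega>. (?S \<omega>)\<^sup>2) = (\<Sum>s\<in>corners n. \<Sum>t\<in>corners n. expectation (\<lambda>\<omega>. ?Z s \<omega> * ?Z t \<omega>))"
    unfolding SS using iZZ by (subst Bochner_Integration.integral_sum, force)+ simp
  also have "\<dots> = (\<Sum>s\<in>corners n. \<Sum>t\<in>corners n. if t = s then cvar E \<mu> n else 0)"
  proof (intro sum.cong refl)
    fix s t assume st: "s \<in> corners n" "t \<in> corners n"
    show "expectation (\<lambda>\<omega>. ?Z s \<omega> * ?Z t \<omega>) = (if t = s then cvar E \<mu> n else 0)"
      using expectation_product_blocks[OF st] expectation_cnt(2)[OF _ shift_Gtilde_subset_SG[OF st(1)]]
      by (auto simp: power2_eq_square)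
  qed
  also have "\<dots> = 3 * cvar E \<mu> n" by (simp add: card_corners)
  finally have ES: "expectation (\<lambda>\<omega>. (?S \<omega>)\<^sup>2) = 3 * cvar E \<mu> n" .
  have iS: "integrable M (\<lambda>\<omega>. (?S \<omega>)\<^sup>2)"
    unfolding SS using iZZ by (intro Bochner_Integration.integrable_sum) auto
  have pw: "(?Y \<omega>)\<^sup>2 \<le> 4 / 3 * (?S \<omega>)\<^sup>2 + 1296" for \<omega>
  proof -
    define r where "r = ?Y \<omega> - ?S \<omega>"
    have "?S \<omega> = (\<Sum>t\<in>corners n. cnt E n (\<lambda>x. V (x + t) \<omega>)) - 3 * cmean E \<mu> n"
      by (simp add: sum_subtractf card_corners)
    \<comment> \<open>The error of the count and the error of its mean contribute 9 each. The
      inequality \<open>(S - 3 * r)^2 >= 0\<close> below says (S + r)^2 <= 4/3 S^2 + 4 r^2, and 4 *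
      18^2 = 1296.\<close>
    then have "\<bar>r\<bar> \<le> 18"
      unfolding r_def using cnt_Suc[of E n "\<lambda>x. V x \<omega>"] cmean_Suc[of E n] by linarith
    then have "r\<^sup>2 \<le> 18\<^sup>2" by (metis abs_le_square_iff abs_numeral)
    moreover have "0 \<le> (?S \<omega> - 3 * r)\<^sup>2" by simp
    moreover have "?Y \<omega> = ?S \<omega> + r" by (simp add: r_def)
    ultimately show ?thesis by (simp add: power2_eq_square algebra_simps)
  qed
  have "cvar E \<mu> (Suc n) = expectation (\<lambda>\<omega>. (?Y \<omega>)\<^sup>2)"
    using expectation_cnt(2)[of "\<lambda>x. x" "Suc n"] Gtilde_subset_SG by simp
  also have "\<dots> \<le> expectation (\<lambda>\<omega>. 4 / 3 * (?S \<omega>)\<^sup>2 + 1296)"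
    using iY iS pw by (intro integral_mono) auto
  also have "\<dots> = 4 * cvar E \<mu> n + 1296" using iS ES by (simp add: prob_space)
  finally show ?thesis .
qed

text \<open>432 = 1296 / 3 is the shift that turns the affine recursion into a purely geometric one:
  4 w + 1296 + 432 = 4 (w + 432).\<close>

lemma cvar_le: "cvar E \<mu> n \<le> (cvar E \<mu> 0 + 432) * 4 ^ n"
proof -
  have "cvar E \<mu> n + 432 \<le> (cvar E \<mu> 0 + 432) * 4 ^ n"
  proof (induction n)
    case (Suc n)
    then show ?case using cvar_Suc[of E n] by simp
  qed simp
  then show ?thesis by simp
qed

text \<open>The variances of \<open>cnt / 3 ^ n\<close> are summable, so the squared deviations are summable almost surely;
  this replaces the strong law of large numbers.\<close>

lemma AE_cnt_concentrates:
  assumes g: "inj_on g SG" "g ` SG \<subseteq> SG"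
  shows "AE \<omega> in M. (\<lambda>n. (cnt E n (\<lambda>x. V (g x) \<omega>) - cmean E \<mu> n) / 3 ^ n) \<longlonglongrightarrow> 0"
proof -
  define f where "f = (\<lambda>n \<omega>. ((cnt E n (\<lambda>x. V (g x) \<omega>) - cmean E \<mu> n) / 3 ^ n)\<^sup>2)"
  define C where "C = cvar E \<mu> 0 + 432"
  have gn: "inj_on g (Gtilde n)" "g ` Gtilde n \<subseteq> SG" for n
    using g Gtilde_subset_SG[of n] by (auto intro: inj_on_subset)
  have meas: "f n \<in> borel_measurable M" for n
    using measurable_cnt[OF gn(2)[of n], of E] unfolding f_def by measurable
  have int: "integrable M (f n)" for n
  proof (rule integrable_const_bound[of _ "((real (card (Gtilde n)) + \<bar>cmean E \<mu> n\<bar>) / 3 ^ n)\<^sup>2"])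
    have sq: "(cnt E n v - cmean E \<mu> n)\<^sup>2 \<le> (real (card (Gtilde n)) + \<bar>cmean E \<mu> n\<bar>)\<^sup>2" for v
      by (rule abs_le_square_iff[THEN iffD1]) (use cnt_bounds[of E n v] in linarith)
    have "norm (f n \<omega>) \<le> ((real (card (Gtilde n)) + \<bar>cmean E \<mu> n\<bar>) / 3 ^ n)\<^sup>2" for \<omega>
      by (simp add: f_def power_divide divide_right_mono[OF sq])
    then show "AE \<omega> in M. norm (f n \<omega>) \<le> ((real (card (Gtilde n)) + \<bar>cmean E \<mu> n\<bar>) / 3 ^ n)\<^sup>2"
      by simp
  qed (rule meas)
  have Ef: "expectation (f n) \<le> C * (4 / 9) ^ n" for n
  proof -
    have "expectation (f n) = cvar E \<mu> n / 9 ^ n"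
      using expectation_cnt(2)[OF gn, of E n]
      by (simp add: f_def power_divide power_mult[symmetric] mult.commute[of n] power_mult[of 3 2])
    also have "\<dots> \<le> C * 4 ^ n / 9 ^ n"
      using cvar_le[of E n] by (intro divide_right_mono) (auto simp: C_def)
    finally show ?thesis by (simp add: power_divide)
  qed
  have nn: "f n \<omega> \<ge> 0" for n \<omega> by (simp add: f_def)
  have C0: "C * (4 / 9) ^ n \<ge> 0" for n
    using Ef[of n] Bochner_Integration.integral_nonneg[of M "f n"] nn by (meson order_trans)
  have sm: "summable (\<lambda>n. C * (4 / 9) ^ n)" by (intro summable_mult summable_geometric) simp
  \<comment> \<open>Tonelli: the expected sum of the squared deviations is dominated by a geometric
    series of ratio 4/9, so the sum is finite almost surely.\<close>
  have "(\<integral>\<^sup>+\<omega>. (\<Sum>n. ennreal (f n \<omega>)) \<partial>M) = (\<Sum>n. \<integral>\<^sup>+\<omega>. ennreal (f n \<omega>) \<partial>M)"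
    using meas by (intro nn_integral_suminf) auto
  also have "\<dots> \<le> (\<Sum>n. ennreal (C * (4 / 9) ^ n))"
    using nn Ef int by (intro suminf_le) (auto simp: nn_integral_eq_integral ennreal_leI)
  also have "\<dots> = ennreal (\<Sum>n. C * (4 / 9) ^ n)" using C0 sm by (intro suminf_ennreal2) auto
  finally have "(\<integral>\<^sup>+\<omega>. (\<Sum>n. ennreal (f n \<omega>)) \<partial>M) \<noteq> \<infinity>" by (metis ennreal_neq_top infinity_ennreal_def top.extremum_uniqueI)
  then have "AE \<omega> in M. (\<Sum>n. ennreal (f n \<omega>)) \<noteq> \<infinity>"
    using meas by (intro nn_integral_PInf_AE) auto
  then show ?thesis
  proof (rule AE_mp, intro always_eventually allI impI)
    fix \<omega> assume fin: "(\<Sum>n. ennreal (f n \<omega>)) \<noteq> \<infinity>"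
    have "summable (\<lambda>n. f n \<omega>)"
      using fin nn by (intro summable_suminf_not_top) auto
    then have "(\<lambda>n. f n \<omega>) \<longlonglongrightarrow> 0" by (rule summable_LIMSEQ_zero)
    then have "(\<lambda>n. sqrt (f n \<omega>)) \<longlonglongrightarrow> sqrt 0" by (rule tendsto_real_sqrt)
    then show "(\<lambda>n. (cnt E n (\<lambda>x. V (g x) \<omega>) - cmean E \<mu> n) / 3 ^ n) \<longlonglongrightarrow> 0"
      unfolding f_def real_sqrt_abs real_sqrt_zero by (rule tendsto_rabs_zero_cancel)
  qed
qed

lemma cmean_limit: obtains e where "(\<lambda>n. cmean E \<mu> n / 3 ^ n) \<longlonglongrightarrow> e"
  using convergent_of_tripling[of "cmean E \<mu>", OF cmean_Suc] by (auto simp: convergent_def)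

text \<open>The relabelling \<open>g\<close> is the identity for the right half and
  \<open>mir\<close> for the left half of a ball; both give the same limit.\<close>

lemma AE_cnt_limit:
  assumes g: "inj_on g SG" "g ` SG \<subseteq> SG" and e: "(\<lambda>n. cmean E \<mu> n / 3 ^ n) \<longlonglongrightarrow> e"
  shows "AE \<omega> in M. (\<lambda>n. cnt E n (\<lambda>x. V (g x) \<omega>) / 3 ^ n) \<longlonglongrightarrow> e"
  using AE_cnt_concentrates[OF g]
proof (rule AE_mp, intro always_eventually allI impI)
  fix \<omega> assume "(\<lambda>n. (cnt E n (\<lambda>x. V (g x) \<omega>) - cmean E \<mu> n) / 3 ^ n) \<longlonglongrightarrow> 0"
  from tendsto_add[OF this e] show "(\<lambda>n. cnt E n (\<lambda>x. V (g x) \<omega>) / 3 ^ n) \<longlonglongrightarrow> e"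
    by (simp add: diff_divide_distrib)
qed

end

theorem theorem4p2:
  fixes M :: "'w measure" and V :: "pt \<Rightarrow> 'w \<Rightarrow> real" and E :: real
  assumes "prob_space M"
    and "\<forall>x\<in>SG. V x \<in> borel_measurable M"
    and "prob_space.indep_vars M (\<lambda>_. borel) V SG"
    and "\<forall>x\<in>SG. \<forall>y\<in>SG. distr M borel (V x) = distr M borel (V y)"
  shows "\<exists>N :: real.
     (\<forall>ch :: nat \<Rightarrow> region \<times> bc.
        (\<lambda>L. (\<integral>\<omega>. real (Ncount E (region_set (fst (ch L)) L) (snd (ch L)) (\<lambda>x. V x \<omega>)) \<partial>M)
               / real (card (Gn L))) \<longlonglongrightarrow> N
      \<and> (AE \<omega> in M. (\<lambda>L. real (Ncount E (region_set (fst (ch L)) L) (snd (ch L)) (\<lambda>x. V x \<omega>))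
               / real (card (Gn L))) \<longlonglongrightarrow> N))
   \<and> (\<forall>b :: bc.
        (\<lambda>L. (\<integral>\<omega>. real (Ncount E (BL L) b (\<lambda>x. V x \<omega>)) \<partial>M) / real (card (BL L))) \<longlonglongrightarrow> N
      \<and> (AE \<omega> in M. (\<lambda>L. real (Ncount E (BL L) b (\<lambda>x. V x \<omega>)) / real (card (BL L))) \<longlonglongrightarrow> N))"
proof -
  interpret prob_space M by fact
  define \<mu> where "\<mu> = distr M borel (V 0)"
  have 0: "0 \<in> SG" using zero_in_corners corners_subset_Gn Gn_subset_SG by blast
  interpret iid_potential M V \<mu>
  proof unfold_locales
    show "V x \<in> borel_measurable M" if "x \<in> SG" for x using assms(2) that by blast
    show "indep_vars (\<lambda>_. borel) V SG" by fact
    show "distr M borel (V x) = \<mu>" if "x \<in> SG" for x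
      unfolding \<mu>_def using assms(4) that 0 by blast
  qed
  obtain k where k: "k \<noteq> 0" "(\<lambda>n. real (card (Gn n)) / 3 ^ n) \<longlonglongrightarrow> k"
    "(\<lambda>n. real (card (BL n)) / 3 ^ n) \<longlonglongrightarrow> 2 * k" by (rule card_limit)
  obtain e where e: "(\<lambda>n. cmean E \<mu> n / 3 ^ n) \<longlonglongrightarrow> e" by (rule cmean_limit)
  have e2: "(\<lambda>n. (cmean E \<mu> n + cmean E \<mu> n) / 3 ^ n) \<longlonglongrightarrow> 2 * e"
    using tendsto_add[OF e e] by (simp add: add_divide_distrib)
  have region: "finite (region_set r n)" "region_set r n \<subseteq> SG" for r n
    using Gn_subset_SG Gtilde_subset_SG by (cases r; simp add: region_set_def)+
  have id: "inj_on (\<lambda>x. x) SG" "(\<lambda>x. x) ` SG \<subseteq> SG" by auto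
  have m: "inj_on mir SG" "mir ` SG \<subseteq> SG" using inj_mir mir_SG by auto
  have mn: "inj_on mir (Gtilde n)" "mir ` Gtilde n \<subseteq> SG" for n
    using inj_mir mir_SG Gtilde_subset_SG[of n] by blast+
  have int: "integrable M (\<lambda>\<omega>. cnt E n (\<lambda>x. V x \<omega>))" "integrable M (\<lambda>\<omega>. cnt E n (\<lambda>x. V (mir x) \<omega>))"
    and exp: "expectation (\<lambda>\<omega>. cnt E n (\<lambda>x. V x \<omega>)) = cmean E \<mu> n"
      "expectation (\<lambda>\<omega>. cnt E n (\<lambda>x. V (mir x) \<omega>)) = cmean E \<mu> n" for n
    using integrable_cnt[of "\<lambda>x. x" n E] integrable_cnt[OF mn(2), of E n] Gtilde_subset_SG[of n]
      expectation_cnt(1)[of "\<lambda>x. x" n E] expectation_cnt(1)[OF mn, of E n] by simp_all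
  show ?thesis
  \<comment> \<open>Here \<open>e\<close> is the limit of the mean count and \<open>k\<close> that
    of the number of vertices, both per \<open>3 ^ n\<close>; neither depends on the sample or on
    the boundary condition.\<close>
  proof (intro exI[of _ "e / k"] conjI allI)
    fix ch :: "nat \<Rightarrow> region \<times> bc"
    show "(\<lambda>L. (\<integral>\<omega>. real (Ncount E (region_set (fst (ch L)) L) (snd (ch L)) (\<lambda>x. V x \<omega>)) \<partial>M)
        / real (card (Gn L))) \<longlonglongrightarrow> e / k"
    \<comment> \<open>The error 18 is uniform over regions and boundary conditions, so the choice
      \<open>ch\<close> may change with the level.\<close>
    proof (rule ratio_limit[OF e k(2,1)])
      fix n
      show "\<bar>expectation (\<lambda>\<omega>. real (Ncount E (region_set (fst (ch n)) n) (snd (ch n)) (\<lambda>x. V x \<omega>)))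
          - cmean E \<mu> n\<bar> \<le> 18"
        unfolding exp(1)[symmetric]
        by (intro expectation_close integrable_Ncount region int Ncount_region_close)
    qed
    show "AE \<omega> in M. (\<lambda>L. real (Ncount E (region_set (fst (ch L)) L) (snd (ch L)) (\<lambda>x. V x \<omega>))
        / real (card (Gn L))) \<longlonglongrightarrow> e / k"
      using AE_cnt_limit[OF id e]
    proof (rule AE_mp, intro always_eventually allI impI)
      fix \<omega> assume "(\<lambda>n. cnt E n (\<lambda>x. V x \<omega>) / 3 ^ n) \<longlonglongrightarrow> e"
      then show "(\<lambda>L. real (Ncount E (region_set (fst (ch L)) L) (snd (ch L)) (\<lambda>x. V x \<omega>))
          / real (card (Gn L))) \<longlonglongrightarrow> e / k"
        by (rule ratio_limit[OF _ k(2,1) Ncount_region_close])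
    qed
  next
    fix b
    \<comment> \<open>For the ball, numerator and denominator both double: two mirror-image
      triangles contribute equal means, and they share only the origin.\<close>
    have "(\<lambda>L. (\<integral>\<omega>. real (Ncount E (BL L) b (\<lambda>x. V x \<omega>)) \<partial>M) / real (card (BL L))) \<longlonglongrightarrow> (2 * e) / (2 * k)"
    proof (rule ratio_limit[OF e2 k(3)])
      fix n
      have "\<bar>expectation (\<lambda>\<omega>. real (Ncount E (BL n) b (\<lambda>x. V x \<omega>)))
          - expectation (\<lambda>\<omega>. cnt E n (\<lambda>x. V x \<omega>) + cnt E n (\<lambda>x. V (mir x) \<omega>))\<bar> \<le> 6"
        by (intro expectation_close integrable_Ncount Ncount_BL_close
            Bochner_Integration.integrable_add int finite_BL BL_subset_SG)
      then show "\<bar>expectation (\<lambda>\<omega>. real (Ncount E (BL n) b (\<lambda>x. V x \<omega>)))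
          - (cmean E \<mu> n + cmean E \<mu> n)\<bar> \<le> 6"
        using int exp by simp
    qed (use k(1) in simp)
    then show "(\<lambda>L. (\<integral>\<omega>. real (Ncount E (BL L) b (\<lambda>x. V x \<omega>)) \<partial>M) / real (card (BL L))) \<longlonglongrightarrow> e / k"
      by simp
    show "AE \<omega> in M. (\<lambda>L. real (Ncount E (BL L) b (\<lambda>x. V x \<omega>)) / real (card (BL L))) \<longlonglongrightarrow> e / k"
      using AE_cnt_limit[OF id e] AE_cnt_limit[OF m e]
    proof eventually_elim
      fix \<omega>
      assume lim: "(\<lambda>n. cnt E n (\<lambda>x. V x \<omega>) / 3 ^ n) \<longlonglongrightarrow> e"
        "(\<lambda>n. cnt E n (\<lambda>x. V (mir x) \<omega>) / 3 ^ n) \<longlonglongrightarrow> e"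
      have "(\<lambda>n. (cnt E n (\<lambda>x. V x \<omega>) + cnt E n (\<lambda>x. V (mir x) \<omega>)) / 3 ^ n) \<longlonglongrightarrow> 2 * e"
        using tendsto_add[OF lim] by (simp add: add_divide_distrib)
      from ratio_limit[OF this k(3) _ Ncount_BL_close] k(1)
      show "(\<lambda>L. real (Ncount E (BL L) b (\<lambda>x. V x \<omega>)) / real (card (BL L))) \<longlonglongrightarrow> e / k"
        by simp
    qed
  qed
qed

end
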